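(* Let $n,p\ge 1$ be integers, let $m_1,\dots,m_p$ be non-negative integers and let $a_1,\dots,a_{2n+2}$, $c_1,\dots,c_p$, $z_1,\dots,z_n$, $w_1,\dots,w_n$ be complex parameters such that, with $A=a_1a_2\cdots a_{2n+2}$ and $|m|=m_1+\dots+m_p$, one has $|q^{1-|m|}/A|<1$ and no denominators in the identity below vanish. Then $$\sum_{y_1,\dots,y_n=-\infty}^\infty\frac{W(zq^y)}{W(z)} \prod_{\substack{1\leq k\leq n\\1\leq j\leq p}} \frac{(q^{m_j}c_jz_k,\,qz_k/c_j)_{y_k}}{(c_jz_k,\,q^{1-m_j}z_k/c_j)_{y_k}} \prod_{\substack {1\leq k\leq n\\1\leq j\leq 2n+2}} \frac{(a_jz_k)_{y_k}}{(qz_k/a_j)_{y_k}}\left(\frac{q^{1-|m|}}A\right)^{|y|}$$ $$=\prod_{1\leq j\leq k\leq n}\frac{(qz_jz_k,\,q/z_jz_k)_\infty} {(qw_jw_k,\,q/w_jw_k)_\infty}\prod_{j,k=1}^n\frac{(qz_k/z_j)_\infty} {(qw_k/w_j)_\infty} \prod_{\substack{1\leq k\leq n\\1\leq j\leq 2n+2}} \frac{(qw_k/a_j,\,q/a_jw_k)_\infty}{(qz_k/a_j,\,q/a_jz_k)_\infty} \prod_{\substack{1\leq k\leq n\\1\leq j\leq p}} \frac{(c_jw_k,\,c_j/w_k)_{m_j}}{(c_jz_k,\,c_j/z_k)_{m_j}}$$ $$\times\sum_{y_1,\dots,y_n=-\infty}^\infty\frac{W(wq^y)}{W(w)} \prod_{\substack{1\leq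 k\leq n\\1\leq j\leq p}} \frac{(q^{m_j}c_jw_k,\,qw_k/c_j)_{y_k}}{(c_jw_k,\,q^{1-m_j}w_k/c_j)_{y_k}} \prod_{\substack {1\leq k\leq n\\1\leq j\leq 2n+2}} \frac{(a_jw_k)_{y_k}}{(qw_k/a_j)_{y_k}}\left(\frac{q^{1-|m|}}A\right)^{|y|}.$$
   Context: Throughout, $q$ is a fixed complex number with $0<|q|<1$. For an integer $k$, $(a)_k=(1-a)(1-aq)\cdots(1-aq^{k-1})$ if $k\ge 0$ (so $(a)_0=1$), and $(a)_k=\dfrac{1}{(1-aq^{-1})(1-aq^{-2})\cdots(1-aq^{k})}$ if $k<0$; $(a)_\infty=\prod_{j=0}^\infty(1-aq^j)$. Also $(a_1,\dots,a_r)_k=(a_1)_k\cdots(a_r)_k$, and likewise with $k=\infty$. An expression such as $q/z_jz_k$ means $q/(z_jz_k)$. For a tuple $y$, $|y|$ denotes the sum of its coordinates, and $zq^y=(z_1q^{y_1},\dots,z_nq^{y_n})$. For an $n$-tuple $u=(u_1,\dots,u_n)$, $W(u)=\prod_{1\le j\le k\le n}(1-u_ju_k)\prod_{1\le j<k\le n}(u_j-u_k)$. Hence $$\frac{W(zq^y)}{W(z)}=\prod_{1\le j\le k\le n}\frac{1-z_jz_kq^{y_j+y_k}}{1-z_jz_k}\prod_{1\le j<k\le n}\frac{q^{y_j}z_j-q^{y_k}z_k}{z_j-z_k},$$ and similarly for $w$. The assumption that no denominators vanish includes that parameters by which one divides are non-zero and that the shifted factorials $(a)_k$ with $k<0$ which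 occur are well defined. The condition $|q^{1-|m|}/A|<1$ ensures that the multiple series over $\mathbb Z^n$ are absolutely convergent. *)

theory Defs
  imports "HOL-Analysis.Analysis"
begin

text \<open>
  Tuples of parameters are functions on \<open>nat\<close> of which only the values at the
  indices \<open>1, ..., n\<close> (respectively \<open>1, ..., p\<close> and \<open>1, ..., 2n+2\<close>) matter.
  The lattice \<open>Z^n\<close> is the set of extensional functions from \<open>{1..n}\<close> to \<open>int\<close>.
\<close>

definition qpoch :: "complex \<Rightarrow> complex \<Rightarrow> int \<Rightarrow> complex" where
  "qpoch q a k =
     (if k \<ge> 0 then \<Prod>i<nat k. (1 - a * q ^ i)
      else 1 / (\<Prod>i=1..nat (- k). (1 - a * q powi (- int i))))"

text \<open>For \<open>k < 0\<close> the shifted factorial is a reciprocal, so it need not exist.\<close>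

definition qpoch_well_defined :: "complex \<Rightarrow> complex \<Rightarrow> int \<Rightarrow> bool" where
  "qpoch_well_defined q a k \<longleftrightarrow>
     (k < 0 \<longrightarrow> (\<Prod>i=1..nat (- k). (1 - a * q powi (- int i))) \<noteq> 0)"

definition qpoch_inf :: "complex \<Rightarrow> complex \<Rightarrow> complex" where
  "qpoch_inf q a = (\<Prod>j. 1 - a * q ^ j)"

definition int_lattice :: "nat \<Rightarrow> (nat \<Rightarrow> int) set" where
  "int_lattice n = {1..n} \<rightarrow>\<^sub>E UNIV"

definition W :: "nat \<Rightarrow> (nat \<Rightarrow> complex) \<Rightarrow> complex" where
  "W n u = (\<Prod>j=1..n. \<Prod>k=j..n. 1 - u j * u k) * (\<Prod>j=1..n. \<Prod>k\<in>{j<..n}. u j - u k)"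

definition qshift :: "complex \<Rightarrow> (nat \<Rightarrow> complex) \<Rightarrow> (nat \<Rightarrow> int) \<Rightarrow> nat \<Rightarrow> complex" where
  "qshift q z y = (\<lambda>k. z k * q powi y k)"

text \<open>
  The summand common to both series; the left-hand series has the variables \<open>z\<close>,
  the right-hand one the variables \<open>w\<close>.
\<close>

definition series_term ::
  "complex \<Rightarrow> nat \<Rightarrow> nat \<Rightarrow> (nat \<Rightarrow> nat) \<Rightarrow> (nat \<Rightarrow> complex) \<Rightarrow> (nat \<Rightarrow> complex) \<Rightarrow>
   (nat \<Rightarrow> complex) \<Rightarrow> (nat \<Rightarrow> int) \<Rightarrow> complex" where
  "series_term q n p m a c z y =
     W n (qshift q z y) / W n z *
     (\<Prod>k=1..n. \<Prod>j=1..p.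
        (qpoch q (q ^ m j * c j * z k) (y k) * qpoch q (q * z k / c j) (y k)) /
        (qpoch q (c j * z k) (y k) * qpoch q (q powi (1 - int (m j)) * z k / c j) (y k))) *
     (\<Prod>k=1..n. \<Prod>j=1..2*n+2. qpoch q (a j * z k) (y k) / qpoch q (q * z k / a j) (y k)) *
     (q powi (1 - int (\<Sum>j=1..p. m j)) / (\<Prod>j=1..2*n+2. a j)) powi (\<Sum>k=1..n. y k)"

text \<open>
  No denominator of \<^const>\<open>series_term\<close> vanishes, for any summation index: each
  coordinate of the index ranges over all integers \<open>l\<close>, all shifted factorials that
  occur have to be well defined, and those in denominators have to be non-zero.
\<close>

definition series_denominators_nonzero ::
  "complex \<Rightarrow> nat \<Rightarrow> nat \<Rightarrow> (nat \<Rightarrow> nat) \<Rightarrow> (nat \<Rightarrow> complex) \<Rightarrow> (nat \<Rightarrow> complex) \<Rightarrow>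
   (nat \<Rightarrow> complex) \<Rightarrow> bool" where
  "series_denominators_nonzero q n p m a c z \<longleftrightarrow>
     W n z \<noteq> 0 \<and>
     (\<forall>k\<in>{1..n}. \<forall>j\<in>{1..p}. \<forall>l.
        qpoch_well_defined q (q ^ m j * c j * z k) l \<and>
        qpoch_well_defined q (q * z k / c j) l \<and>
        qpoch_well_defined q (c j * z k) l \<and>
        qpoch_well_defined q (q powi (1 - int (m j)) * z k / c j) l \<and>
        qpoch q (c j * z k) l \<noteq> 0 \<and>
        qpoch q (q powi (1 - int (m j)) * z k / c j) l \<noteq> 0) \<and>
     (\<forall>k\<in>{1..n}. \<forall>j\<in>{1..2*n+2}. \<forall>l.
        qpoch_well_defined q (a j * z k) l \<and>
        qpoch_well_defined q (q * z k / a j) l \<and>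
        qpoch q (q * z k / a j) l \<noteq> 0)"

end

(* Expanding W(z) as a combination of products of one-variable functions turns the left-hand side,
   after clearing the prefactor, into an expression Omega(z) which in every variable is a bilateral
   average  sum_y z^((2n+2)y) q^((n+1)y^2) f(z q^y)  of a function f with f(1/z) = -f(z).  Such an
   average is holomorphic on the punctured plane, odd under z -> 1/z and satisfies
   F(qz) = q^(-n-1) z^(-2n-2) F(z).  A function of this kind vanishing at n points in general
   position has 2n + 4 zeros modulo multiplication by q (the points, their inverses, and the square
   roots of 1 and q), too many for a theta function of degree 2n + 2, hence it is zero.  Therefore
   an alternating function of n variables with these properties is determined up to a constant
   factor.  The theta-function analogue Delta of the Weyl denominator of type C has them too,
   so Omega(z) Delta(w) = Omega(w) Delta(z), which is the identity. *)

theory Submission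
  imports Defs "HOL-Complex_Analysis.Complex_Analysis" "HOL-Combinatorics.Permutations"
begin

subsection \<open>Zeros of theta functions\<close>

text \<open>The argument \<open>q powi (1 - |m|) / A\<close> of the series is the one for which the
  parameters disappear from the weight: the factors with \<open>a j\<close> contribute
  \<open>A\<close> and a Gaussian, those with \<open>c j\<close> contribute \<open>q\<close> to the
  power \<open>|m| * y\<close>, the Weyl denominator contributes \<open>q\<close> to the power
  \<open>n * y\<close>, and the total is free of \<open>a\<close>, \<open>c\<close> and
  \<open>m\<close>. The class of functions is thus fixed by \<open>q\<close> and \<open>n\<close>.
  Odd theta functions of degree \<open>2n + 2\<close> are divisible by
  \<open>theta (z * z) / z\<close>, which leaves even ones of degree \<open>2n - 2\<close>, a space
  of dimension \<open>n\<close>; alternating functions of \<open>n\<close> variables over it form a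
  top exterior power, which is a line. Evaluation at the \<open>n\<close> points \<open>w k\<close>
  takes the place of the dimension count, so only \<open>w\<close> has to be in general position,
  and this is what the nonvanishing denominators provide. The obstacle is convergence once
  \<open>W\<close> is split: a one-variable average converges because no variable occurs in more
  than \<open>n - 1\<close> Vandermonde factors.\<close>

lemma holomorphic_quotient_simple_zeros:
  fixes f t :: "complex \<Rightarrow> complex"
  assumes f: "f holomorphic_on S" and t: "t holomorphic_on S" and S: "open S"
    and zero: "\<And>a. a \<in> S \<Longrightarrow> t a = 0 \<Longrightarrow> f a = 0 \<and> deriv t a \<noteq> 0"
  obtains g where "g holomorphic_on S" "\<And>x. x \<in> S \<Longrightarrow> f x = g x * t x"
proof
  \<comment> \<open>At a zero of \<open>t\<close> the value is the l'Hospital limit of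
    \<open>f x / t x\<close>; the zero is simple, so the limit is finite and the singularity
    removable.\<close>
  define g where "g x = (if t x = 0 then deriv f x / deriv t x else f x / t x)" for x
  show "f x = g x * t x" if "x \<in> S" for x
    using zero[OF that] by (auto simp: g_def)
  have away: "g holomorphic_on U" if "U \<subseteq> S" "\<And>x. x \<in> U \<Longrightarrow> t x \<noteq> 0" for U
  proof -
    have "(\<lambda>x. f x / t x) holomorphic_on U"
      using that holomorphic_on_subset[OF f] holomorphic_on_subset[OF t]
      by (intro holomorphic_intros) auto
    thus ?thesis
      by (rule holomorphic_transform) (use that in \<open>auto simp: g_def\<close>)
  qed
  have "\<exists>U. open U \<and> a \<in> U \<and> g holomorphic_on U" if a: "a \<in> S" for a
  proof (cases "t a = 0")
    case False
    have "open (S \<inter> t -` (- {0}))"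
      by (intro continuous_open_preimage holomorphic_on_imp_continuous_on t S) auto
    moreover have "g holomorphic_on (S \<inter> t -` (- {0}))"
      by (rule away) auto
    ultimately show ?thesis
      using a False by (intro exI[of _ "S \<inter> t -` (- {0})"]) auto
  next
    case True
    from zero[OF a True] have fa: "f a = 0" and ta: "deriv t a \<noteq> 0" by auto
    have df: "((\<lambda>x. f x / (x - a)) \<longlongrightarrow> deriv f a) (at a)"
      using holomorphic_derivI[OF f S a] fa by (simp add: has_field_derivative_iff)
    have dt: "((\<lambda>x. t x / (x - a)) \<longlongrightarrow> deriv t a) (at a)"
      using holomorphic_derivI[OF t S a] True by (simp add: has_field_derivative_iff)
    \<comment> \<open>The nonzero derivative also isolates the zero \<open>a\<close> of
      \<open>t\<close>.\<close>
    have "eventually (\<lambda>x. t x / (x - a) \<noteq> 0) (at a)"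
      by (rule tendsto_imp_eventually_ne[OF dt ta])
    hence ev: "eventually (\<lambda>x. t x \<noteq> 0) (at a)"
      by eventually_elim auto
    moreover have "eventually (\<lambda>x. x \<in> S) (at a)"
      by (rule eventually_at_in_open'[OF S a])
    ultimately have "eventually (\<lambda>x. t x \<noteq> 0 \<and> x \<in> S) (at a)"
      by eventually_elim auto
    then obtain U where U: "open U" "a \<in> U" "\<And>x. x \<in> U - {a} \<Longrightarrow> t x \<noteq> 0 \<and> x \<in> S"
      unfolding eventually_at_topological by auto
    have "((\<lambda>x. (f x / (x - a)) / (t x / (x - a))) \<longlongrightarrow> deriv f a / deriv t a) (at a)"
      by (intro tendsto_divide df dt ta)
    moreover have "eventually (\<lambda>x. (f x / (x - a)) / (t x / (x - a)) = g x) (at a)"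
      using ev eventually_neq_at_within[of a a UNIV]
      by eventually_elim (auto simp: g_def divide_simps)
    ultimately have "(g \<longlongrightarrow> deriv f a / deriv t a) (at a)"
      by (rule Lim_transform_eventually)
    hence lim: "(g \<longlongrightarrow> g a) (at a)"
      using True by (simp add: g_def)
    have "g holomorphic_on U"
    proof (rule no_isolated_singularity'[where K = "{a}"])
      show "g holomorphic_on U - {a}"
        by (rule away) (use U in auto)
      show "\<And>z. z \<in> {a} \<Longrightarrow> (g \<longlongrightarrow> g z) (at z within U)"
        using lim by (auto intro: tendsto_within_subset)
    qed (use U in auto)
    thus ?thesis using U by auto
  qed
  then obtain U where U: "\<And>a. a \<in> S \<Longrightarrow> open (U a) \<and> a \<in> U a \<and> g holomorphic_on (U a)"
    by metis
  show "g holomorphic_on S"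
    using U S by (meson analytic_imp_holomorphic analytic_on_analytic_at analytic_at)
qed

section \<open>Infinite shifted factorials and the theta function\<close>

locale nome =
  fixes q :: complex
  assumes norm_q: "0 < norm q" "norm q < 1"
begin

lemma q_nz [simp]: "q \<noteq> 0"
  using norm_q by auto

lemma summable_norm_qpow: "summable (\<lambda>j. norm (x * q ^ j))"
  using norm_q by (simp add: norm_mult norm_power summable_mult)

lemma convergent_prod_qpoch: "convergent_prod (\<lambda>j. 1 - x * q ^ j)"
  by (intro abs_convergent_prod_imp_convergent_prod summable_imp_abs_convergent_prod)
     (use summable_norm_qpow[of x] in simp)

lemma LIMSEQ_qpoch_inf: "(\<lambda>n. \<Prod>i<n. 1 - x * q ^ i) \<longlonglongrightarrow> qpoch_inf q x"
  using convergent_prod_LIMSEQ[OF convergent_prod_qpoch[of x]]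
  by (simp add: qpoch_inf_def LIMSEQ_lessThan_iff_atMost)

text \<open>A convergent infinite product vanishes only if one of its factors does.\<close>

lemma qpoch_inf_eq_0_iff: "qpoch_inf q x = 0 \<longleftrightarrow> (\<exists>j. x * q ^ j = 1)"
proof -
  have "(\<lambda>j. 1 - x * q ^ j) has_prod qpoch_inf q x"
    unfolding qpoch_inf_def by (intro convergent_prod_has_prod convergent_prod_qpoch)
  from has_prod_eq_0_iff[OF this] show ?thesis
    by (force simp: image_iff)
qed

lemma qpoch_inf_rec: "qpoch_inf q x = (1 - x) * qpoch_inf q (q * x)"
proof (rule LIMSEQ_unique)
  show "(\<lambda>n. \<Prod>i<Suc n. 1 - x * q ^ i) \<longlonglongrightarrow> qpoch_inf q x"
    using LIMSEQ_qpoch_inf[of x] by (rule LIMSEQ_Suc)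
  have "(\<lambda>n. (1 - x) * (\<Prod>i<n. 1 - q * x * q ^ i)) \<longlonglongrightarrow> (1 - x) * qpoch_inf q (q * x)"
    by (intro tendsto_mult tendsto_const LIMSEQ_qpoch_inf)
  thus "(\<lambda>n. \<Prod>i<Suc n. 1 - x * q ^ i) \<longlonglongrightarrow> (1 - x) * qpoch_inf q (q * x)"
    by (simp add: prod.lessThan_Suc_shift mult_ac del: prod.lessThan_Suc)
qed

lemma norm_qpoch_prod_le: "norm (\<Prod>i<n. 1 - x * q ^ i) \<le> exp (norm x / (1 - norm q))"
proof -
  have "norm (\<Prod>i<n. 1 - x * q ^ i) \<le> (\<Prod>i<n. 1 + norm (x * q ^ i))"
    unfolding prod_norm[symmetric] by (intro prod_mono) (auto intro: norm_triangle_le_diff)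
  also have "\<dots> \<le> exp (\<Sum>i<n. norm (x * q ^ i))"
    by (rule prod_le_exp_sum) auto
  also have "(\<Sum>i<n. norm (x * q ^ i)) \<le> (\<Sum>i. norm (x * q ^ i))"
    by (intro sum_le_suminf summable_norm_qpow) auto
  also have "\<dots> = norm x / (1 - norm q)"
    using norm_q by (simp add: norm_mult norm_power suminf_mult suminf_geometric summable_geometric)
  finally show ?thesis by simp
qed

lemma norm_qpoch_inf_le: "norm (qpoch_inf q x) \<le> exp (norm x / (1 - norm q))"
  by (rule LIMSEQ_le_const2[OF tendsto_norm[OF LIMSEQ_qpoch_inf]]) (auto intro: norm_qpoch_prod_le)

lemma holomorphic_qpoch_inf_UNIV: "qpoch_inf q holomorphic_on UNIV"
proof (rule holomorphic_uniform_sequence)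
  fix x :: complex
  define R where "R = norm x + 1"
  have "uniformly_convergent_on (cball x 1) (\<lambda>N y. \<Prod>n<N. 1 - y * q ^ n)"
  proof (rule uniformly_convergent_on_prod')
    show "uniformly_convergent_on (cball x 1) (\<lambda>N y. \<Sum>n<N. norm (1 - y * q ^ n - 1))"
    proof (rule Weierstrass_m_test')
      show "summable (\<lambda>n. R * norm q ^ n)"
        using norm_q by (simp add: summable_mult)
      fix n y assume "y \<in> cball x 1"
      hence "norm y \<le> R"
        unfolding R_def using norm_triangle_ineq2[of y x] by (auto simp: dist_norm norm_minus_commute)
      thus "norm (norm (1 - y * q ^ n - 1)) \<le> R * norm q ^ n"
        by (auto simp: norm_mult norm_power intro: mult_right_mono)
    qed
  qed (auto intro!: continuous_intros)
  then obtain l where l: "uniform_limit (cball x 1) (\<lambda>N y. \<Prod>n<N. 1 - y * q ^ n) l sequentially"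
    by (auto simp: uniformly_convergent_on_def)
  have "l y = qpoch_inf q y" if "y \<in> cball x 1" for y
    using tendsto_uniform_limitI[OF l that] LIMSEQ_qpoch_inf LIMSEQ_unique by blast
  hence "uniform_limit (cball x 1) (\<lambda>N y. \<Prod>n<N. 1 - y * q ^ n) (qpoch_inf q) sequentially"
    using l by (subst uniform_limit_cong'[where g = "\<lambda>N y. \<Prod>n<N. 1 - y * q ^ n" and i = l]) auto
  thus "\<exists>d>0. cball x d \<subseteq> UNIV \<and>
          uniform_limit (cball x d) (\<lambda>N y. \<Prod>n<N. 1 - y * q ^ n) (qpoch_inf q) sequentially"
    by (intro exI[of _ 1]) auto
qed (auto intro!: holomorphic_intros)

lemma holomorphic_qpoch_inf [holomorphic_intros]:
  "f holomorphic_on S \<Longrightarrow> (\<lambda>x. qpoch_inf q (f x)) holomorphic_on S"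
  using holomorphic_on_compose_gen[OF _ holomorphic_qpoch_inf_UNIV, of f S] by (simp add: o_def)

text \<open>The multiplicative form of the Jacobi theta function; the integral powers of
  \<open>q\<close> are its zeros, all simple.\<close>

definition theta :: "complex \<Rightarrow> complex" where
  "theta x = qpoch_inf q x * qpoch_inf q (q / x)"

text \<open>Isolates the trigonometric factor \<open>1 - x\<close>. It gives the derivative at 1,
  and later the comparison of theta products with \<open>W\<close>.\<close>

lemma theta_eq: "theta x = (1 - x) * (qpoch_inf q (q * x) * qpoch_inf q (q / x))"
  by (simp add: theta_def qpoch_inf_rec[of x])

lemma theta_q: "x \<noteq> 0 \<Longrightarrow> theta (q * x) = - theta x / x"
  using qpoch_inf_rec[of x] qpoch_inf_rec[of "1 / x"]
  by (simp add: theta_def) (simp add: field_simps)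

lemma theta_inverse: "x \<noteq> 0 \<Longrightarrow> theta (1 / x) = - theta x / x"
  using theta_q[of x] by (simp add: theta_def mult.commute)

lemma holomorphic_theta [holomorphic_intros]:
  "f holomorphic_on S \<Longrightarrow> (\<And>x. x \<in> S \<Longrightarrow> f x \<noteq> 0) \<Longrightarrow> (\<lambda>x. theta (f x)) holomorphic_on S"
  unfolding theta_def by (intro holomorphic_intros) auto

lemma theta_eq_0_iff:
  assumes "x \<noteq> 0"
  shows "theta x = 0 \<longleftrightarrow> (\<exists>l::int. x = q powi l)"
proof
  assume "theta x = 0"
  then consider j where "x * q ^ j = 1" | j where "q / x * q ^ j = 1"
    by (auto simp: theta_def qpoch_inf_eq_0_iff)
  thus "\<exists>l::int. x = q powi l"
  proof cases
    case 1
    hence "x = q powi (- int j)"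
      by (simp add: power_int_minus field_simps)
    thus ?thesis ..
  next
    case 2
    hence "x = q ^ Suc j"
      using assms by (simp add: field_simps)
    hence "x = q powi int (Suc j)"
      by (simp only: power_int_of_nat)
    thus ?thesis ..
  qed
next
  assume "\<exists>l::int. x = q powi l"
  then obtain l :: int where l: "x = q powi l" by auto
  show "theta x = 0"
  proof (cases "l \<le> 0")
    case True
    hence "x * q ^ nat (- l) = 1"
      by (simp add: l power_int_def field_simps split: if_splits)
    thus ?thesis by (auto simp: theta_def qpoch_inf_eq_0_iff)
  next
    case False
    hence "x = q ^ Suc (nat (l - 1))"
      by (simp add: l power_int_def Suc_nat_eq_nat_zadd1 flip: power_Suc)
    hence "q / x * q ^ nat (l - 1) = 1"
      by simp
    thus ?thesis unfolding theta_def using qpoch_inf_eq_0_iff by force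
  qed
qed

text \<open>At 1 the zero is simple by the product formula. Differentiating
  \<open>theta (q * x) = - theta x / x\<close> at a zero carries simplicity along the orbit of 1 in
  both directions.\<close>

lemma deriv_theta_q_nonzero: "deriv theta (q powi l) \<noteq> 0"
proof -
  have step: "q * deriv theta (q * x) = - deriv theta x / x" if x: "x \<noteq> 0" "theta x = 0" for x
  proof -
    have hol: "theta holomorphic_on -{0}"
      using holomorphic_theta[of "\<lambda>x. x" "-{0}"] by simp
    have D: "(theta has_field_derivative deriv theta y) (at y)" if "y \<noteq> 0" for y
      by (rule holomorphic_derivI[OF hol]) (use that in auto)
    have "((\<lambda>x. theta (q * x)) has_field_derivative deriv theta (q * x) * q) (at x)"
      by (rule DERIV_chain2[OF D]) (use x in \<open>auto intro!: derivative_eq_intros\<close>)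
    moreover have "((\<lambda>x. - theta x / x) has_field_derivative - deriv theta x / x) (at x)"
      by (rule derivative_eq_intros D refl | use x in \<open>simp add: field_simps\<close>)+
    moreover have "eventually (\<lambda>y. - theta y / y = theta (q * y)) (nhds x)"
      by (rule eventually_mono[OF eventually_nhds_in_open[of "-{0}"]]) (use x in \<open>auto simp: theta_q\<close>)
    ultimately have "((\<lambda>x. theta (q * x)) has_field_derivative - deriv theta x / x) (at x)"
      by (simp add: DERIV_cong_ev)
    with \<open>((\<lambda>x. theta (q * x)) has_field_derivative deriv theta (q * x) * q) (at x)\<close>
    show ?thesis by (metis DERIV_unique mult.commute)
  qed
  have zero: "theta (q powi l) = 0" for l
    using theta_eq_0_iff[of "q powi l"] by auto
  show ?thesis
  proof (induction l rule: int_induct[where k = 0])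
    case base
    define K where "K x = qpoch_inf q (q * x) * qpoch_inf q (q / x)" for x
    have K: "K holomorphic_on -{0}"
      unfolding K_def by (intro holomorphic_intros) auto
    have "(K has_field_derivative deriv K 1) (at 1)"
      by (rule holomorphic_derivI[OF K]) auto
    hence "((\<lambda>x. (1 - x) * K x) has_field_derivative - K 1) (at 1)"
      by (auto intro!: derivative_eq_intros)
    hence "(theta has_field_derivative - K 1) (at 1)"
      by (simp add: theta_eq[abs_def] K_def)
    moreover have "K 1 \<noteq> 0"
    proof
      assume "K 1 = 0"
      then obtain j where "q ^ Suc j = 1" by (auto simp: K_def qpoch_inf_eq_0_iff)
      hence "norm q ^ Suc j = 1" by (metis norm_power norm_one)
      thus False using norm_q power_Suc_less_one[of "norm q" j] by auto
    qed
    ultimately show ?case by (simp add: DERIV_imp_deriv)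
  next
    case (step1 i)
    thus ?case
      using step[of "q powi i"] zero[of i] by (auto simp: power_int_add mult.commute)
  next
    case (step2 i)
    have "q * q powi (i - 1) = q powi i"
      by (simp add: power_int_diff)
    thus ?case
      using step[of "q powi (i - 1)"] zero[of "i - 1"] step2 by auto
  qed
qed

section \<open>Quasi-periodic functions on the punctured plane\<close>

definition quasi :: "complex \<Rightarrow> int \<Rightarrow> (complex \<Rightarrow> complex) \<Rightarrow> bool" where
  "quasi C N f \<longleftrightarrow> f holomorphic_on -{0} \<and> (\<forall>z. z \<noteq> 0 \<longrightarrow> f (q * z) = C * z powi (- N) * f z)"

text \<open>For negative degree the multiplier \<open>C * z ^ M\<close> has \<open>M > 0\<close>, so
  it is small near 0 and large near infinity. Going from a central annulus towards either end
  therefore never increases the norm, and the bound on a compact annulus is global.\<close>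

lemma quasi_negative_bounded:
  assumes f: "quasi C N f" and N: "N < 0" and C: "C \<noteq> 0"
  shows "\<exists>B. \<forall>z. z \<noteq> 0 \<longrightarrow> norm (f z) \<le> B"
proof -
  define M where "M = nat (- N)"
  have M: "M > 0" "- N = int M" using N by (auto simp: M_def)
  have rec: "f (q * z) = C * z ^ M * f z" if "z \<noteq> 0" for z
    using f that M by (auto simp: quasi_def)
  \<comment> \<open>Where \<open>norm z <= r\<close> the multiplier has modulus at most 1; where
    \<open>norm z >= R\<close> it has modulus at least 1.\<close>
  define r where "r = min 1 (1 / norm C)"
  define R where "R = max 1 (1 / norm C)"
  have rR: "0 < r" "r \<le> 1" "1 \<le> R" "norm C * r \<le> 1" "norm C * R \<ge> 1"
    using C by (auto simp: r_def R_def field_simps min_def max_def)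
  \<comment> \<open>The exponent is \<open>Suc k\<close> so that a point below \<open>A k\<close>
    satisfies \<open>norm (z / q) <= r\<close> and a point above it satisfies
    \<open>norm (q * z) >= R\<close>: the multiplier estimates apply to the neighbour one step
    further in.\<close>
  define A where "A k = {z::complex. norm q ^ Suc k * r \<le> norm z \<and> norm z \<le> R / norm q ^ Suc k}" for k
  have A0: "compact (A 0)"
  proof -
    have "closed {z. norm q ^ Suc 0 * r \<le> norm (z::complex)}"
      by (intro closed_Collect_le continuous_intros)
    moreover have "A 0 = cball 0 (R / norm q ^ Suc 0) \<inter> {z. norm q ^ Suc 0 * r \<le> norm z}"
      by (auto simp: A_def)
    ultimately show ?thesis by (simp only:) (rule compact_Int_closed[OF compact_cball])
  qed
  have A_nz: "z \<noteq> 0" if "z \<in> A k" for z k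
  proof -
    have "0 < norm q ^ Suc k * r"
      using rR norm_q by (intro mult_pos_pos zero_less_power) auto
    thus ?thesis using that by (auto simp: A_def)
  qed
  have A0': "A 0 \<subseteq> -{0}" using A_nz by auto
  have "continuous_on (A 0) f"
    using f A0' unfolding quasi_def by (meson holomorphic_on_imp_continuous_on continuous_on_subset)
  hence "bounded (f ` A 0)"
    by (intro compact_imp_bounded compact_continuous_image A0)
  then obtain B where B: "\<And>z. z \<in> A 0 \<Longrightarrow> norm (f z) \<le> B"
    by (auto simp: bounded_iff)
  have bound: "z \<in> A k \<Longrightarrow> norm (f z) \<le> B" for k z
  proof (induction k arbitrary: z)
    case 0
    thus ?case by (rule B)
  next
    case (Suc k)
    have z: "z \<noteq> 0" using A_nz[OF Suc.prems] .
    consider "z \<in> A k" | "norm z < norm q ^ Suc k * r" | "norm z > R / norm q ^ Suc k"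
      by (force simp: A_def)
    thus ?case
    proof cases
      case 1
      thus ?thesis by (rule Suc.IH)
    next
      case 2
      define y where "y = z / q"
      have ny: "norm y = norm z / norm q" by (simp add: y_def norm_divide)
      have lo: "norm q ^ Suc k * r \<le> norm y"
        using Suc.prems norm_q by (simp add: A_def ny field_simps)
      have "norm y \<le> norm q ^ k * r"
        using 2 norm_q by (simp add: ny field_simps)
      also have "\<dots> \<le> 1 * r"
        using norm_q rR by (intro mult_right_mono power_le_one) auto
      finally have yr: "norm y \<le> r" by simp
      have "1 \<le> R / norm q ^ Suc k"
        using rR norm_q power_le_one[of "norm q" "Suc k"] by (simp add: field_simps del: power_Suc)
      hence "norm y \<le> R / norm q ^ Suc k"
        using yr rR by linarith
      hence "norm (f y) \<le> B"
        using lo yr rR by (intro Suc.IH) (simp add: A_def del: power_Suc)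
      moreover have "norm C * norm y ^ M \<le> 1"
      proof -
        have "norm y ^ M \<le> norm y ^ 1"
          using yr rR M by (intro power_decreasing) auto
        hence "norm C * norm y ^ M \<le> norm C * r"
          using yr by (intro mult_left_mono) auto
        thus ?thesis using rR by simp
      qed
      moreover have "norm (f z) = norm C * norm y ^ M * norm (f y)"
        using rec[of y] z by (simp add: y_def norm_mult norm_power)
      ultimately show ?thesis
        by (smt (verit) mult_left_le_one_le norm_ge_zero mult_nonneg_nonneg zero_le_power)
    next
      case 3
      have lo: "norm (q * z) \<le> R / norm q ^ Suc k"
        using Suc.prems norm_q by (simp add: A_def norm_mult field_simps)
      have Rq: "R \<le> R / norm q ^ k"
        using rR norm_q power_le_one[of "norm q" k] by (simp add: field_simps mult_left_le)
      have "norm q * norm z \<ge> R / norm q ^ k"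
        using 3 norm_q by (simp add: field_simps)
      with Rq have qz: "R \<le> norm (q * z)" by (simp add: norm_mult)
      have "norm q ^ Suc k * r \<le> 1 * 1"
        using rR norm_q by (intro mult_mono power_le_one) auto
      hence "norm (f (q * z)) \<le> B"
        using lo qz rR by (intro Suc.IH) (simp add: A_def)
      moreover have "norm C * norm z ^ M \<ge> 1"
      proof -
        have zR: "R \<le> norm z"
          using qz norm_q rR by (smt (verit) norm_mult mult_left_le_one_le norm_ge_zero)
        have "norm z ^ 1 \<le> norm z ^ M"
          using zR rR M by (intro power_increasing) auto
        hence "norm C * R \<le> norm C * norm z ^ M"
          using zR by (intro mult_left_mono) auto
        thus ?thesis using rR by simp
      qed
      moreover have "norm (f (q * z)) = norm C * norm z ^ M * norm (f z)"
        using rec[of z] z by (simp add: norm_mult norm_power)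
      ultimately show ?thesis
        by (smt (verit) mult_le_cancel_right1 norm_ge_zero)
    qed
  qed
  have "norm (f z) \<le> B" if z: "z \<noteq> 0" for z
  proof -
    have lim: "(\<lambda>k. norm q ^ Suc k) \<longlonglongrightarrow> 0"
      using norm_q by (intro LIMSEQ_Suc LIMSEQ_power_zero) auto
    have "eventually (\<lambda>k. norm q ^ Suc k < min (norm z / r) (R / norm z)) sequentially"
      by (rule order_tendstoD(2)[OF lim]) (use z rR in auto)
    then obtain k where "norm q ^ Suc k < min (norm z / r) (R / norm z)"
      by (auto simp: eventually_sequentially)
    moreover have "norm q ^ Suc k > 0" using norm_q by (intro zero_less_power)
    ultimately have "z \<in> A k"
      using rR z by (simp add: A_def field_simps del: power_Suc)
    thus ?thesis by (rule bound)
  qed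
  thus ?thesis by blast
qed

text \<open>Composed with \<open>exp\<close>, the bounded \<open>f\<close> becomes a bounded entire
  function, hence constant by Liouville. A nonzero constant would force the multiplier to be 1 at
  every point, in particular at both 1 and \<open>q\<close>, which a nonzero degree
  excludes.\<close>

lemma quasi_negative_eq_0:
  assumes f: "quasi C N f" and N: "N < 0" and C: "C \<noteq> 0" and z: "z \<noteq> 0"
  shows "f z = 0"
proof -
  obtain B where B: "\<And>z. z \<noteq> 0 \<Longrightarrow> norm (f z) \<le> B"
    using quasi_negative_bounded[OF f N C] by auto
  have "(f \<circ> exp) holomorphic_on UNIV"
    by (rule holomorphic_on_compose_gen[where t = "-{0}"])
       (use f in \<open>auto simp: quasi_def intro!: holomorphic_intros\<close>)
  moreover have "bounded (range (f \<circ> exp))"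
    unfolding bounded_iff by (rule exI[of _ B]) (use B in auto)
  ultimately have "(f \<circ> exp) constant_on UNIV"
    by (rule Liouville_theorem)
  then obtain c where c: "\<And>t. f (exp t) = c"
    by (auto simp: constant_on_def)
  have const: "f x = c" if "x \<noteq> 0" for x
    using c[of "Ln x"] that by simp
  have eq: "c = C * x powi (- N) * c" if "x \<noteq> 0" for x
    using f that const[of x] const[of "q * x"] by (auto simp: quasi_def)
  have "c = 0"
  proof (rule ccontr)
    assume "c \<noteq> 0"
    with eq[of 1] eq[of q] have "q powi (- N) = 1" by auto
    hence "norm q ^ nat (- N) = 1"
      using N by (simp add: power_int_def flip: norm_power)
    moreover have "norm q ^ nat (- N) < 1"
      using N norm_q by (intro power_less_one_iff[THEN iffD2]) auto
    ultimately show False by simp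
  qed
  thus ?thesis using const z by simp
qed

lemma quasi_zero_shift:
  assumes f: "quasi C N f" and C: "C \<noteq> 0" and x: "x \<noteq> 0" "f x = 0"
  shows "f (x * q powi l) = 0"
proof (induction l rule: int_induct[where k = 0])
  case base
  thus ?case using x by simp
next
  case (step1 i)
  have "f (q * (x * q powi i)) = 0"
    using f x step1 unfolding quasi_def by auto
  thus ?case by (simp add: power_int_add mult_ac)
next
  case (step2 i)
  let ?y = "x * q powi (i - 1)"
  have "q * ?y = x * q powi i"
    by (simp add: power_int_diff)
  hence "C * ?y powi (- N) * f ?y = 0"
    using f x step2 unfolding quasi_def by (metis mult_eq_0_iff power_int_eq_0_iff q_nz)
  thus ?case using C x by auto
qed

text \<open>Each zero is divided out by a theta function until the degree is negative.\<close>

lemma quasi_many_zeros_eq_0: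
  assumes "finite X"
    and "quasi C N f" "C \<noteq> 0" "N < int (card X)"
    and "\<And>x. x \<in> X \<Longrightarrow> x \<noteq> 0 \<and> f x = 0"
    and "\<And>x y l. x \<in> X \<Longrightarrow> y \<in> X \<Longrightarrow> x \<noteq> y \<Longrightarrow> x \<noteq> y * q powi l"
    and "z \<noteq> 0"
  shows "f z = 0"
  using assms
proof (induction X arbitrary: C N f z rule: finite_induct)
  case empty
  thus ?case using quasi_negative_eq_0 by simp
next
  case (insert a X)
  have f: "f holomorphic_on -{0}" and rec: "\<And>z. z \<noteq> 0 \<Longrightarrow> f (q * z) = C * z powi (- N) * f z"
    using insert.prems by (auto simp: quasi_def)
  have a: "a \<noteq> 0" "f a = 0" using insert.prems(4)[of a] by auto
  define t where "t x = theta (x / a)" for x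
  have t: "t holomorphic_on -{0}"
    unfolding t_def using a by (intro holomorphic_intros) auto
  have hol: "theta holomorphic_on -{0}"
    using holomorphic_theta[of "\<lambda>x. x" "-{0}"] by simp
  have zero: "f b = 0 \<and> deriv t b \<noteq> 0" if b: "b \<in> -{0}" "t b = 0" for b
  proof -
    obtain l where l: "b / a = q powi l"
      using b a theta_eq_0_iff[of "b / a"] by (auto simp: t_def)
    have bl: "b = a * q powi l" using l a by (simp add: field_simps)
    have "(theta has_field_derivative deriv theta (b / a)) (at (b / a))"
      by (rule holomorphic_derivI[OF hol]) (use a b in auto)
    hence "(t has_field_derivative deriv theta (b / a) * (1 / a)) (at b)"
      unfolding t_def by (rule DERIV_chain2) (use a in \<open>auto intro!: derivative_eq_intros\<close>)
    hence "deriv t b = deriv theta (q powi l) * (1 / a)"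
      using l by (simp add: DERIV_imp_deriv)
    hence "deriv t b \<noteq> 0" using deriv_theta_q_nonzero a by simp
    moreover have "f b = 0"
      unfolding bl by (rule quasi_zero_shift[OF insert.prems(1,2) a])
    ultimately show ?thesis by simp
  qed
  have op: "open (-{0::complex})" by (rule open_Compl) simp
  obtain g where g: "g holomorphic_on -{0}" "\<And>x. x \<in> -{0} \<Longrightarrow> f x = g x * t x"
    using holomorphic_quotient_simple_zeros[OF f t op zero] by blast
  have tq: "t (q * x) = - a / x * t x" if "x \<noteq> 0" for x
    using theta_q[of "x / a"] that a by (simp add: t_def)
  have grec: "g (q * x) = (- C / a) * x powi (- (N - 1)) * g x" if x: "x \<noteq> 0" for x
  proof -
    \<comment> \<open>Cancelling \<open>t x\<close> proves the functional equation of
      \<open>g\<close> only off the zeros of \<open>t\<close>. These are isolated, so continuity of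
      the defect \<open>D\<close> settles the remaining points.\<close>
    define D where "D x = g (q * x) - (- C / a) * x powi (- (N - 1)) * g x" for x
    have D: "D x = 0" if "x \<noteq> 0" "t x \<noteq> 0" for x
    proof -
      have "g (q * x) * (- a / x * t x) = C * x powi (- N) * (g x * t x)"
        using rec[of x] g(2)[of x] g(2)[of "q * x"] tq[of x] that by auto
      hence "- (a * (t x * g (q * x))) = C * (x * (g x * (t x * x powi - N)))"
        using that(1) a by (simp add: field_simps)
      from arg_cong[OF this, of uminus]
      have "t x * (a * g (q * x)) = t x * (- (C * (x * (g x * x powi - N))))"
        by (simp add: mult_ac)
      hence "a * g (q * x) = - (C * (x * (g x * x powi - N)))"
        using that(2) mult_left_cancel by blast
      hence "g (q * x) = (- C / a) * (x * x powi (- N)) * g x"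
        using a by (simp add: field_simps)
      also have "x * x powi (- N) = x powi (- (N - 1))"
        using that using power_int_add_1'[of x "- N"] by (simp add: algebra_simps)
      finally show ?thesis by (simp add: D_def)
    qed
    have "isCont D x"
    proof -
      have "D holomorphic_on -{0}"
        unfolding D_def
        by (intro holomorphic_intros holomorphic_on_compose_gen[OF _ g(1), unfolded o_def] g(1)) auto
      thus ?thesis using x
        by (metis Compl_iff continuous_on_eq_continuous_at holomorphic_on_imp_continuous_on op singletonD)
    qed
    hence "(D \<longlongrightarrow> D x) (at x)" by (simp add: isCont_def)
    moreover have "eventually (\<lambda>y. D y = 0) (at x)"
    proof -
      have "eventually (\<lambda>y. t y \<noteq> 0) (at x)"
      proof (cases "t x = 0")
        case True
        have "((\<lambda>y. t y / (y - x)) \<longlongrightarrow> deriv t x) (at x)"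
          using holomorphic_derivI[OF t op, of x] True x by (simp add: has_field_derivative_iff)
        hence "eventually (\<lambda>y. t y / (y - x) \<noteq> 0) (at x)"
          by (rule tendsto_imp_eventually_ne) (use zero[of x] True x in auto)
        thus ?thesis by eventually_elim auto
      next
        case False
        have "isCont t x"
          using t x by (metis Compl_iff continuous_on_eq_continuous_at holomorphic_on_imp_continuous_on op singletonD)
        thus ?thesis using False by (auto simp: isCont_def intro: tendsto_imp_eventually_ne)
      qed
      moreover have "eventually (\<lambda>y. y \<in> -{0}) (at x)"
        by (rule eventually_at_in_open') (use x in auto)
      ultimately show ?thesis
        by eventually_elim (use D in auto)
    qed
    hence "(D \<longlongrightarrow> 0) (at x)"
      by (rule tendsto_eventually)
    ultimately have "D x = 0"
      using tendsto_unique[OF at_neq_bot] by blast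
    thus ?thesis by (simp add: D_def eq_neg_iff_add_eq_0)
  qed
  have "g x = 0" if "x \<noteq> 0" for x
  proof (rule insert.IH[OF _ _ _ _ _ that])
    show "quasi (- C / a) (N - 1) g"
      using g(1) grec by (auto simp: quasi_def)
    show "- C / a \<noteq> 0" using insert.prems(2) a by simp
    show "N - 1 < int (card X)" using insert.prems insert.hyps by simp
    show "x \<noteq> y * q powi l" if "x \<in> X" "y \<in> X" "x \<noteq> y" for x y l
      using insert.prems(5) that by blast
    \<comment> \<open>Since \<open>x\<close> and \<open>a\<close> are inequivalent modulo powers of
      \<open>q\<close>, \<open>t\<close> does not vanish at \<open>x\<close> and the zero of
      \<open>f\<close> there survives in \<open>g\<close>.\<close>
    show "x \<noteq> 0 \<and> g x = 0" if x: "x \<in> X" for x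
    proof -
      have x0: "x \<noteq> 0" "f x = 0" using insert.prems(4)[of x] x by auto
      have "x \<noteq> a" using x insert.hyps by auto
      hence "x \<noteq> a * q powi l" for l using insert.prems(5)[of x a l] x by auto
      hence "t x \<noteq> 0" using a x0 theta_eq_0_iff[of "x / a"] by (auto simp: t_def field_simps)
      thus ?thesis using g(2)[of x] x0 by auto
    qed
  qed
  thus ?case using g(2)[of z] insert.prems(6) by auto
qed

end

subsection \<open>Alternating theta functions\<close>

definition pairs :: "nat \<Rightarrow> (nat \<times> nat) set" where
  "pairs n = (SIGMA j:{1..n}. {j<..n})"

lemma finite_pairs [simp]: "finite (pairs n)"
  by (simp add: pairs_def)

lemma mem_pairs: "(j, k) \<in> pairs n \<longleftrightarrow> 1 \<le> j \<and> j < k \<and> k \<le> n"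
  by (auto simp: pairs_def)

lemma prod_pairs: "(\<Prod>j=1..n. \<Prod>k\<in>{j<..n}. F j k) = (\<Prod>(j, k)\<in>pairs n. F j k)"
  unfolding pairs_def by (rule prod.Sigma) auto

text \<open>The transposition permutes the unordered pairs and reverses the order of exactly
  \<open>(a, b)\<close>, the pairs \<open>(a, k)\<close> and the pairs \<open>(k, b)\<close> with
  \<open>a < k < b\<close>. Their number is odd, so antisymmetry of \<open>F\<close> leaves one
  sign.\<close>

lemma prod_pairs_transpose_less:
  fixes F :: "nat \<Rightarrow> nat \<Rightarrow> 'a::comm_ring_1"
  assumes ab: "1 \<le> a" "a < b" "b \<le> n"
    and anti: "\<And>i j. i \<in> {1..n} \<Longrightarrow> j \<in> {1..n} \<Longrightarrow> i \<noteq> j \<Longrightarrow> F i j = - F j i"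
  shows "(\<Prod>(j, k)\<in>pairs n. F (Transposition.transpose a b j) (Transposition.transpose a b k)) = - (\<Prod>(j, k)\<in>pairs n. F j k)"
proof -
  define t where "t = Transposition.transpose a b"
  have tt: "t (t x) = x" for x by (simp add: t_def)
  have tn: "t x \<in> {1..n}" if "x \<in> {1..n}" for x
    using that ab by (auto simp: t_def Transposition.transpose_def)
  define g where "g = (\<lambda>(j, k). if t j < t k then (t j, t k) else (t k, t j))"
  have g_pairs: "g p \<in> pairs n" if "p \<in> pairs n" for p
  proof -
    obtain j k where p: "p = (j, k)" by (cases p)
    hence jk: "j \<in> {1..n}" "k \<in> {1..n}" "j \<noteq> k" using that by (auto simp: mem_pairs)
    have "t j \<noteq> t k" using jk(3) tt by metis
    thus ?thesis using tn[OF jk(1)] tn[OF jk(2)] by (auto simp: p g_def mem_pairs)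
  qed
  have gg: "g (g p) = p" if "p \<in> pairs n" for p
    using that tt by (cases p) (auto simp: g_def mem_pairs)
  have bij: "bij_betw g (pairs n) (pairs n)"
    by (rule bij_betw_byWitness[where f' = g]) (use gg g_pairs in auto)
  define I where "I = {p \<in> pairs n. t (snd p) < t (fst p)}"
  have I_eq: "I = insert (a, b) (Pair a ` {a<..<b} \<union> (\<lambda>k. (k, b)) ` {a<..<b})"
    using ab by (auto simp: I_def mem_pairs t_def Transposition.transpose_def image_iff split: if_splits)
  have "card (Pair a ` {a<..<b} \<union> (\<lambda>k. (k, b)) ` {a<..<b}) = 2 * card {a<..<b}"
    by (subst card_Un_disjoint) (auto simp: card_image inj_on_def)
  moreover have "(a, b) \<notin> Pair a ` {a<..<b} \<union> (\<lambda>k. (k, b)) ` {a<..<b}"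
    by auto
  ultimately have cardI: "card I = Suc (2 * card {a<..<b})"
    unfolding I_eq by (subst card_insert_disjoint) auto
  have "(\<Prod>(j, k)\<in>pairs n. F (t j) (t k))
      = (\<Prod>p\<in>pairs n. (if t (snd p) < t (fst p) then - 1 else 1) * (case g p of (j, k) \<Rightarrow> F j k))"
  proof (rule prod.cong[OF refl])
    fix p assume "p \<in> pairs n"
    then obtain j k where p: "p = (j, k)" "j \<in> {1..n}" "k \<in> {1..n}" "j \<noteq> k"
      by (cases p) (auto simp: mem_pairs)
    have "t j \<noteq> t k" using p(4) tt by metis
    thus "(case p of (j, k) \<Rightarrow> F (t j) (t k)) =
        (if t (snd p) < t (fst p) then - 1 else 1) * (case g p of (j, k) \<Rightarrow> F j k)"
      using anti[of "t j" "t k"] tn[OF p(2)] tn[OF p(3)] by (auto simp: p(1) g_def)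
  qed
  also have "\<dots> = (\<Prod>p\<in>pairs n. if t (snd p) < t (fst p) then - 1 else 1)
      * (\<Prod>p\<in>pairs n. case g p of (j, k) \<Rightarrow> F j k)"
    by (rule prod.distrib)
  also have "(\<Prod>p\<in>pairs n. case g p of (j, k) \<Rightarrow> F j k) = (\<Prod>(j, k)\<in>pairs n. F j k)"
    by (rule prod.reindex_bij_betw[OF bij])
  also have "(\<Prod>p\<in>pairs n. if t (snd p) < t (fst p) then - 1 else 1 :: 'a) = (- 1) ^ card I"
    by (simp add: prod.If_cases I_def Int_def)
  also have "\<dots> = - 1" by (simp add: cardI)
  finally show ?thesis by (simp add: t_def)
qed

lemma prod_pairs_transpose:
  fixes F :: "nat \<Rightarrow> nat \<Rightarrow> 'a::comm_ring_1"
  assumes ab: "a \<in> {1..n}" "b \<in> {1..n}" "a \<noteq> b"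
    and anti: "\<And>i j. i \<in> {1..n} \<Longrightarrow> j \<in> {1..n} \<Longrightarrow> i \<noteq> j \<Longrightarrow> F i j = - F j i"
  shows "(\<Prod>(j, k)\<in>pairs n. F (Transposition.transpose a b j) (Transposition.transpose a b k)) = - (\<Prod>(j, k)\<in>pairs n. F j k)"
proof (cases "a < b")
  case True
  show ?thesis
    by (rule prod_pairs_transpose_less[OF _ True _ anti]) (use ab in auto)
next
  case False
  hence "b < a" using ab by simp
  thus ?thesis
    unfolding Transposition.transpose_commute[of a b]
    by (rule prod_pairs_transpose_less[OF _ _ _ anti, rotated]) (use ab in auto)
qed

lemma bij_betw_transpose: "a \<in> S \<Longrightarrow> b \<in> S \<Longrightarrow> bij_betw (Transposition.transpose a b) S S"
  by (rule bij_betw_byWitness[where f' = "Transposition.transpose a b"]) (auto simp: Transposition.transpose_def)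

text \<open>The source of every \<open>n - 1\<close> below: in the degree of \<open>Delta\<close>,
  in the powers split off \<open>W\<close>, and in the bound for the exponents of the Vandermonde
  expansion.\<close>

lemma card_pairs_incident:
  assumes "i \<in> {1..n}"
  shows "card {p \<in> pairs n. fst p = i \<or> snd p = i} = n - 1"
proof -
  have "{p \<in> pairs n. fst p = i \<or> snd p = i} = Pair i ` {i<..n} \<union> (\<lambda>k. (k, i)) ` {1..<i}"
    using assms by (auto simp: mem_pairs)
  moreover have "card (Pair i ` {i<..n} \<union> (\<lambda>k. (k, i)) ` {1..<i}) = (n - i) + (i - 1)"
    by (subst card_Un_disjoint) (auto simp: card_image inj_on_def)
  ultimately show ?thesis using assms by simp
qed

section \<open>Quasi-periodic functions with an inversion symmetry\<close>

context nome
begin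

text \<open>The multiplier \<open>C\<close>, the degree \<open>N\<close> and the sign
  \<open>s\<close> are separate parameters because a product of functions multiplies the first and
  the last and adds the degrees.\<close>

definition qsym :: "complex \<Rightarrow> int \<Rightarrow> complex \<Rightarrow> (complex \<Rightarrow> complex) \<Rightarrow> bool" where
  "qsym C N s f \<longleftrightarrow> quasi C N f \<and> (\<forall>z. z \<noteq> 0 \<longrightarrow> f (1 / z) = s * f z)"

lemma qsym_const: "qsym 1 0 1 (\<lambda>_. c)"
  by (auto simp: qsym_def quasi_def)

lemma qsym_mult:
  assumes "qsym C N s f" "qsym C' N' s' g"
  shows "qsym (C * C') (N + N') (s * s') (\<lambda>x. f x * g x)"
proof -
  have "(\<lambda>x. f x * g x) holomorphic_on -{0}"
    using assms by (intro holomorphic_intros) (auto simp: qsym_def quasi_def)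
  moreover have "f (q * z) * g (q * z) = C * C' * z powi (- (N + N')) * (f z * g z)" if "z \<noteq> 0" for z
  proof -
    have "z powi (- (N + N')) = z powi (- N) * z powi (- N')"
      using that power_int_add[of z "- N" "- N'"] by simp
    moreover have "f (q * z) = C * z powi (- N) * f z" "g (q * z) = C' * z powi (- N') * g z"
      using assms that unfolding qsym_def quasi_def by blast+
    ultimately show ?thesis by (simp only: mult_ac)
  qed
  moreover have "f (1 / z) * g (1 / z) = s * s' * (f z * g z)" if "z \<noteq> 0" for z
    using assms that by (simp add: qsym_def mult_ac)
  ultimately show ?thesis by (simp add: qsym_def quasi_def)
qed

lemma qsym_transform:
  assumes f: "qsym C N s f" and eq: "\<And>z. z \<noteq> 0 \<Longrightarrow> f z = g z"
  shows "qsym C N s g"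
proof -
  have "g holomorphic_on -{0}"
    by (rule holomorphic_transform[of f]) (use f eq in \<open>auto simp: qsym_def quasi_def\<close>)
  moreover have "g (q * z) = C * z powi (- N) * g z" "g (1 / z) = s * g z" if "z \<noteq> 0" for z
    using f that eq[of z] eq[of "q * z"] eq[of "1 / z"] by (auto simp: qsym_def quasi_def)
  ultimately show ?thesis by (simp add: qsym_def quasi_def)
qed

lemma qsym_cmult: "qsym C N s f \<Longrightarrow> qsym C N s (\<lambda>x. c * f x)"
  using qsym_mult[OF qsym_const[of c], of C N s f] by simp

lemma qsym_add: "qsym C N s f \<Longrightarrow> qsym C N s g \<Longrightarrow> qsym C N s (\<lambda>x. f x + g x)"
  unfolding qsym_def quasi_def by (simp add: distrib_left holomorphic_on_add)

lemma qsym_zero: "qsym C N s (\<lambda>_. 0)"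
  by (auto simp: qsym_def quasi_def)

lemma qsym_sum: "(\<And>i. i \<in> I \<Longrightarrow> qsym C N s (f i)) \<Longrightarrow> qsym C N s (\<lambda>x. \<Sum>i\<in>I. f i x)"
  by (induction I rule: infinite_finite_induct) (auto intro: qsym_add qsym_zero)

lemma qsym_diff: "qsym C N s f \<Longrightarrow> qsym C N s g \<Longrightarrow> qsym C N s (\<lambda>x. f x - g x)"
  unfolding qsym_def quasi_def by (simp add: right_diff_distrib holomorphic_on_diff)

lemma qsym_prod:
  "(\<And>i. i \<in> I \<Longrightarrow> qsym (C i) (N i) (s i) (f i)) \<Longrightarrow>
   qsym (\<Prod>i\<in>I. C i) (\<Sum>i\<in>I. N i) (\<Prod>i\<in>I. s i) (\<lambda>x. \<Prod>i\<in>I. f i x)"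
  by (induction I rule: infinite_finite_induct) (auto intro: qsym_mult qsym_const)

lemma norm_q_powi_inj:
  assumes "norm q powi a = norm q powi b"
  shows "a = b"
proof -
  have *: "norm q powi k \<noteq> 1" if "k > 0" for k
  proof -
    have "norm q ^ nat k < 1"
      using that norm_q by (intro power_less_one_iff[THEN iffD2]) auto
    thus ?thesis using that by (simp add: power_int_def)
  qed
  have "norm q powi (a - b) = 1" "norm q powi (b - a) = 1"
    using assms norm_q by (auto simp: power_int_diff)
  thus ?thesis using *[of "a - b"] *[of "b - a"] by (metis diff_gt_0_iff_gt linorder_neqE)
qed

text \<open>Says that the \<open>2n\<close> points \<open>w k\<close> and \<open>1 / w k\<close> are
  inequivalent modulo powers of \<open>q\<close>. The case \<open>j = k\<close> of the product
  condition separates them from the square roots of 1 and \<open>q\<close> as well.\<close>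

definition generic :: "nat \<Rightarrow> (nat \<Rightarrow> complex) \<Rightarrow> bool" where
  "generic n w \<longleftrightarrow> (\<forall>k\<in>{1..n}. w k \<noteq> 0) \<and>
     (\<forall>j\<in>{1..n}. \<forall>k\<in>{1..n}. \<forall>l::int. w j * w k \<noteq> q powi l \<and> (j \<noteq> k \<longrightarrow> w j \<noteq> w k * q powi l))"

lemma generic_nonzero: "generic n w \<Longrightarrow> k \<in> {1..n} \<Longrightarrow> w k \<noteq> 0"
  unfolding generic_def by blast

lemma generic_mult: "generic n w \<Longrightarrow> j \<in> {1..n} \<Longrightarrow> k \<in> {1..n} \<Longrightarrow> w j * w k \<noteq> q powi l"
  unfolding generic_def by blast

lemma generic_ratio:
  "generic n w \<Longrightarrow> j \<in> {1..n} \<Longrightarrow> k \<in> {1..n} \<Longrightarrow> j \<noteq> k \<Longrightarrow> w j \<noteq> w k * q powi l"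
  unfolding generic_def by blast

text \<open>Besides \<open>w j\<close> and \<open>1 / w j\<close>, a function of this class vanishes at the square roots of
  \<open>1\<close> and \<open>q\<close>; three of these already make more than \<open>2n + 2\<close> zeros.\<close>

lemma qsym_odd_eq_0:
  assumes w: "generic n w"
    and f: "qsym (q powi (- int (n + 1))) (2 * int n + 2) (- 1) f"
    and zeros: "\<And>k. k \<in> {1..n} \<Longrightarrow> f (w k) = 0"
    and z: "z \<noteq> 0"
  shows "f z = 0"
proof -
  define r where "r = csqrt q"
  have rr: "r * r = q" by (simp add: r_def flip: power2_eq_square)
  have r0: "r \<noteq> 0" using rr by auto
  have fq: "f (q * x) = q powi (- int (n + 1)) * x powi (- (2 * int n + 2)) * f x"
    and fi: "f (1 / x) = - f x" if "x \<noteq> 0" for x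
    using f that by (auto simp: qsym_def quasi_def)
  have w0: "w k \<noteq> 0" if "k \<in> {1..n}" for k using generic_nonzero[OF w that] .
  have ww: "w j * w k \<noteq> q powi l" if "j \<in> {1..n}" "k \<in> {1..n}" for j k l
    using generic_mult[OF w that] .
  have wd: "w j \<noteq> w k * q powi l" if "j \<in> {1..n}" "k \<in> {1..n}" "j \<noteq> k" for j k l
    using generic_ratio[OF w that] .
  define E where "E = {1, - 1, r}"
  define X where "X = w ` {1..n} \<union> (\<lambda>k. 1 / w k) ` {1..n}"
  \<comment> \<open>The point \<open>r\<close> is fixed by inversion followed by multiplication with
    \<open>q\<close>; the multiplier there is exactly 1, so oddness gives
    \<open>f r = - f r\<close>.\<close>
  have fr: "f r = 0"
  proof -
    have "q * (1 / r) = r" using rr r0 by (simp add: field_simps)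
    moreover have "(1 / r) powi (- (2 * int n + 2)) = q ^ (n + 1)"
    proof -
      have "(1 / r) powi (- (2 * int n + 2)) = r powi (2 * int n + 2)"
        by (simp only: power_int_minus power_int_divide_distrib) (simp add: field_simps)
      also have "\<dots> = r powi int (2 * (n + 1))"
        by (simp add: algebra_simps)
      also have "\<dots> = q ^ (n + 1)"
        by (simp only: power_int_of_nat power_mult power2_eq_square rr)
      finally show ?thesis .
    qed
    moreover have "q powi (- int (n + 1)) * q ^ (n + 1) = 1"
      by (simp only: power_int_minus power_int_of_nat) (simp add: field_simps)
    ultimately have "f r = - f r"
      using fq[of "1 / r"] fi[of r] r0 by (simp del: power_Suc add: mult.assoc)
    thus ?thesis by simp
  qed
  have Esq: "\<exists>l. e * e = q powi l" if "e \<in> E" for e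
  proof -
    have "e * e = q powi 0 \<or> e * e = q powi 1" using that rr by (auto simp: E_def)
    thus ?thesis by blast
  qed
  have E0: "e \<noteq> 0" if "e \<in> E" for e using that r0 by (auto simp: E_def)
  \<comment> \<open>The square of each \<open>e\<close> is a power of \<open>q\<close>, so an
    equivalence with \<open>w k\<close> or its inverse would make \<open>w k * w k\<close> a power
    of \<open>q\<close>.\<close>
  have XE: "x \<noteq> e * q powi l" if x: "x \<in> X" and e: "e \<in> E" for x e l
  proof
    assume eq: "x = e * q powi l"
    obtain m where m: "e * e = q powi m" using Esq[OF e] by auto
    have xx: "x * x = q powi (m + 2 * l)"
      using m eq by (simp add: power_int_add power_int_mult power2_eq_square mult_ac
                          flip: power_int_mult_distrib)
    from x obtain k where k: "k \<in> {1..n}" "x = w k \<or> x = 1 / w k" by (auto simp: X_def)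
    have "w k * w k = q powi (m + 2 * l) \<or> w k * w k = q powi (- (m + 2 * l))"
    proof (cases "x = w k")
      case False
      hence "x * w k = 1" using k w0[OF k(1)] by auto
      hence "(x * x) * (w k * w k) = 1" by (metis mult.assoc mult.commute mult_1)
      hence "w k * w k = 1 / (x * x)" by (metis eq_divide_imp mult.commute mult_zero_left zero_neq_one)
      thus ?thesis by (simp only: xx power_int_minus) (simp add: field_simps)
    qed (use xx in simp)
    thus False using ww[OF k(1) k(1)] by blast
  qed
  have XX: "x \<noteq> y * q powi l" if x: "x \<in> X" and y: "y \<in> X" and "x \<noteq> y" for x y l
  proof
    assume eq: "x = y * q powi l"
    from x obtain j where j: "j \<in> {1..n}" "x = w j \<or> x = 1 / w j" by (auto simp: X_def)
    from y obtain k where k: "k \<in> {1..n}" "y = w k \<or> y = 1 / w k" by (auto simp: X_def)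
    note nz = w0[OF j(1)] w0[OF k(1)]
    consider "x = w j" "y = w k" | "x = w j" "y = 1 / w k" | "x = 1 / w j" "y = w k"
      | "x = 1 / w j" "y = 1 / w k" using j k by blast
    thus False
    proof cases
      case 1
      thus False using eq \<open>x \<noteq> y\<close> wd[OF j(1) k(1), of l] by metis
    next
      case 2
      hence "w j * w k = q powi l" using eq nz by (simp add: field_simps)
      thus False using ww j k by blast
    next
      case 3
      hence "w j * w k = q powi (- l)" using eq nz by (simp add: power_int_minus field_simps)
      thus False using ww j k by blast
    next
      case 4
      hence "w k = w j * q powi l" using eq nz by (simp add: field_simps)
      thus False using 4 \<open>x \<noteq> y\<close> wd[OF k(1) j(1), of l] by metis
    qed
  qed
  have nr: "norm r * norm r = norm q" using rr by (metis norm_mult)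
  \<comment> \<open>Absolute values suffice: the norm of \<open>r\<close> is a half-integral power
    of \<open>norm q\<close>.\<close>
  have r_q: "norm r \<noteq> norm q powi l" for l
  proof
    assume "norm r = norm q powi l"
    hence "norm q powi 1 = norm q powi (2 * l)"
      using nr by (metis mult_2 norm_ge_zero norm_q(1) power_int_1_right power_int_add less_irrefl)
    from norm_q_powi_inj[OF this] show False by presburger
  qed
  have EE: "x \<noteq> y * q powi l" if x: "x \<in> E" and y: "y \<in> E" and "x \<noteq> y" for x y l
  proof
    assume eq: "x = y * q powi l"
    have nx: "norm x = norm y * norm q powi l"
      by (simp add: eq norm_mult norm_power_int)
    have l0: "l = 0" if "1 = norm q powi l"
      using norm_q_powi_inj[of 0 l] that by simp
    have "norm x = 1 \<or> x = r" "norm y = 1 \<or> y = r" using x y by (auto simp: E_def)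
    moreover have "\<not> (norm x = 1 \<and> norm y = 1)"
    proof
      assume "norm x = 1 \<and> norm y = 1"
      hence "1 = norm q powi l" using nx by auto
      hence "l = 0" by (rule l0)
      thus False using eq \<open>x \<noteq> y\<close> by simp
    qed
    moreover have "\<not> (x = r \<and> norm y = 1)" using nx r_q by auto
    moreover have "\<not> (norm x = 1 \<and> y = r)"
    proof
      assume "norm x = 1 \<and> y = r"
      hence "1 = norm r * norm q powi l" using nx by metis
      hence "norm r = norm q powi (- l)" by (simp add: power_int_minus field_simps)
      thus False using r_q by blast
    qed
    ultimately show False using \<open>x \<noteq> y\<close> by blast
  qed
  have injw: "inj_on w {1..n}"
    by (rule inj_onI, rule ccontr) (use wd[where l = 0] in \<open>simp; blast\<close>)
  have cardX: "card X = 2 * n"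
  proof -
    have inj: "inj_on (\<lambda>k. 1 / w k) {1..n}"
    proof (rule inj_onI)
      fix j k assume "j \<in> {1..n}" "k \<in> {1..n}" "1 / w j = 1 / w k"
      thus "j = k" using inj_onD[OF injw] by (metis div_by_1 divide_divide_eq_right mult_1)
    qed
    have disj: "w ` {1..n} \<inter> (\<lambda>k. 1 / w k) ` {1..n} = {}"
    proof (rule equals0I)
      fix x assume "x \<in> w ` {1..n} \<inter> (\<lambda>k. 1 / w k) ` {1..n}"
      then obtain j k where jk: "j \<in> {1..n}" "k \<in> {1..n}" "x = w j" "x = 1 / w k" by blast
      hence "w j = 1 / w k" by metis
      hence "w j * w k = q powi 0" using w0[OF jk(2)] by simp
      thus False using ww[OF jk(1,2)] by blast
    qed
    have "card X = card (w ` {1..n}) + card ((\<lambda>k. 1 / w k) ` {1..n})"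
      unfolding X_def by (rule card_Un_disjoint[OF _ _ disj]) auto
    thus ?thesis by (simp only: card_image[OF injw] card_image[OF inj]) simp
  qed
  have cardE: "card E = 3"
  proof -
    have "r \<noteq> 1" "r \<noteq> - 1" using r_q[of 0] by auto
    thus ?thesis by (simp add: E_def)
  qed
  have disj: "X \<inter> E = {}" using XE[where l = 0] by (metis disjoint_iff mult_1_right power_int_0_right)
  have card: "card (X \<union> E) = 2 * n + 3"
  proof -
    have "card (X \<union> E) = card X + card E"
      by (rule card_Un_disjoint[OF _ _ disj]) (auto simp: X_def E_def)
    thus ?thesis by (simp add: cardX cardE)
  qed
  have fin: "finite (X \<union> E)" by (simp add: X_def E_def)
  show ?thesis
  proof (rule quasi_many_zeros_eq_0[where X = "X \<union> E" and f = f and z = z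
        and C = "q powi (- int (n + 1))" and N = "2 * int n + 2"])
    show "quasi (q powi (- int (n + 1))) (2 * int n + 2) f" using f by (simp add: qsym_def)
    show "2 * int n + 2 < int (card (X \<union> E))" by (simp add: card)
    show "x \<noteq> 0 \<and> f x = 0" if "x \<in> X \<union> E" for x
    proof (cases "x \<in> E")
      case True
      moreover have "f 1 = 0" "f (- 1) = 0" using fi[of 1] fi[of "- 1"] by auto
      ultimately show ?thesis using E0[OF True] fr by (auto simp: E_def)
    next
      case False
      hence "x \<in> X" using that by simp
      then obtain k where k: "k \<in> {1..n}" "x = w k \<or> x = 1 / w k" by (auto simp: X_def)
      thus ?thesis using zeros[OF k(1)] fi[OF w0[OF k(1)]] w0[OF k(1)] by auto
    qed
    show "x \<noteq> y * q powi l" if "x \<in> X \<union> E" "y \<in> X \<union> E" "x \<noteq> y" for x y l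
    proof
      assume eq: "x = y * q powi l"
      hence "y = x * q powi (- l)" by (simp add: power_int_minus field_simps)
      thus False using eq that XX EE XE by blast
    qed
    show "q powi (- int (n + 1)) \<noteq> 0" by simp
  qed (fact fin z)+
qed

text \<open>Induction on the number of coordinates of \<open>z\<close> outside the set of the
  \<open>w k\<close>. If there are none, \<open>z\<close> either is a permutation of
  \<open>w\<close> or repeats a coordinate, and \<open>F\<close> vanishes by antisymmetry. Otherwise
  one outside coordinate is made variable: by induction \<open>F\<close> vanishes when it equals any
  \<open>w j\<close>, and these are enough zeros for \<open>qsym_odd_eq_0\<close>.\<close>

lemma alternating_eq_0:
  fixes F :: "(nat \<Rightarrow> complex) \<Rightarrow> complex"
  assumes w: "generic n w"
    and cong: "\<And>u v. (\<And>k. k \<in> {1..n} \<Longrightarrow> u k = v k) \<Longrightarrow> F u = F v"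
    and qs: "\<And>u i. i \<in> {1..n} \<Longrightarrow> (\<And>k. k \<in> {1..n} \<Longrightarrow> u k \<noteq> 0) \<Longrightarrow>
        qsym (q powi (- int (n + 1))) (2 * int n + 2) (- 1) (\<lambda>s. F (u(i := s)))"
    and anti: "\<And>u i j. i \<in> {1..n} \<Longrightarrow> j \<in> {1..n} \<Longrightarrow> i \<noteq> j \<Longrightarrow> (\<And>k. k \<in> {1..n} \<Longrightarrow> u k \<noteq> 0) \<Longrightarrow>
        F (u \<circ> Transposition.transpose i j) = - F u"
    and Fw: "F w = 0"
    and z: "\<And>k. k \<in> {1..n} \<Longrightarrow> z k \<noteq> 0"
  shows "F z = 0"
proof -
  have w0: "w k \<noteq> 0" if "k \<in> {1..n}" for k using generic_nonzero[OF w that] .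
  have perm: "F (u \<circ> p) = 0"
    if "p permutes {1..n}" "F u = 0" "\<And>k. k \<in> {1..n} \<Longrightarrow> u k \<noteq> 0" for p u
    using that(1) finite_atLeastAtMost that(2,3)
  proof (induction p arbitrary: u rule: permutes_induct)
    case id
    thus ?case by simp
  next
    case (swap a b p)
    have "F (u \<circ> Transposition.transpose a b) = 0"
      using anti[of a b u] swap by simp
    moreover have "(u \<circ> Transposition.transpose a b) k \<noteq> 0" if "k \<in> {1..n}" for k
      using swap that by (auto simp: Transposition.transpose_def)
    ultimately have "F ((u \<circ> Transposition.transpose a b) \<circ> p) = 0"
      by (rule swap.IH)
    thus ?case by (simp only: o_assoc)
  qed
  show ?thesis
    using z
  proof (induction "card {k \<in> {1..n}. z k \<notin> w ` {1..n}}" arbitrary: z)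
    case 0
    hence "\<forall>k\<in>{1..n}. z k \<in> w ` {1..n}" by auto
    hence "\<forall>k\<in>{1..n}. \<exists>j\<in>{1..n}. z k = w j" by auto
    then obtain h where h: "\<And>k. k \<in> {1..n} \<Longrightarrow> h k \<in> {1..n} \<and> z k = w (h k)" by metis
    show ?case
    proof (cases "inj_on h {1..n}")
      case True
      define p where "p k = (if k \<in> {1..n} then h k else k)" for k
      have "h ` {1..n} = {1..n}"
        using True h by (intro endo_inj_surj) auto
      hence "bij_betw h {1..n} {1..n}"
        using True by (simp add: bij_betw_def)
      hence "bij_betw p {1..n} {1..n}"
        by (rule bij_betw_cong[THEN iffD1, rotated]) (simp add: p_def)
      hence "p permutes {1..n}"
        by (rule bij_imp_permutes) (auto simp: p_def)
      hence "F (w \<circ> p) = 0" by (rule perm[OF _ Fw w0])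
      moreover have "F z = F (w \<circ> p)"
        by (rule cong) (use h in \<open>auto simp: p_def\<close>)
      ultimately show ?thesis by simp
    next
      case False
      then obtain i j where ij: "i \<in> {1..n}" "j \<in> {1..n}" "i \<noteq> j" "h i = h j"
        by (auto simp: inj_on_def)
      hence "z i = z j" using h by auto
      hence "z \<circ> Transposition.transpose i j = z" by (auto simp: Transposition.transpose_def fun_eq_iff)
      hence "F z = - F z" using anti[OF ij(1-3), of z] 0 by simp
      thus ?thesis by simp
    qed
  next
    case (Suc m)
    have "{k \<in> {1..n}. z k \<notin> w ` {1..n}} \<noteq> {}" using Suc.hyps(2) by (metis card.empty nat.distinct(1))
    then obtain i where i: "i \<in> {1..n}" "z i \<notin> w ` {1..n}" by blast
    have "F (z(i := s)) = 0" if "s \<noteq> 0" for s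
    proof (rule qsym_odd_eq_0[OF w qs[of i z] _ that])
      show "F (z(i := w j)) = 0" if j: "j \<in> {1..n}" for j
      proof (rule Suc.hyps(1))
        define S where "S = {k \<in> {1..n}. (z(i := w j)) k \<notin> w ` {1..n}}"
        have S: "{k \<in> {1..n}. z k \<notin> w ` {1..n}} = insert i S" "i \<notin> S"
          using i j by (auto simp: S_def)
        have "finite S" by (simp add: S_def)
        have "Suc m = Suc (card S)"
          using Suc.hyps(2) unfolding S(1) card_insert_disjoint[OF \<open>finite S\<close> S(2)] .
        thus "m = card {k \<in> {1..n}. (z(i := w j)) k \<notin> w ` {1..n}}"
          by (simp add: S_def)
        show "\<And>k. k \<in> {1..n} \<Longrightarrow> (z(i := w j)) k \<noteq> 0" using Suc.prems j w0 by auto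
      qed
    qed (use i Suc.prems in auto)
    from this[of "z i"] show ?case using Suc.prems i by simp
  qed
qed

text \<open>Theta deformation of
  \<open>(1 - s * t) * (1 - s / t) / s = s + 1 / s - t - 1 / t\<close>. The division by
  \<open>s\<close> makes it antisymmetric in \<open>s\<close> and \<open>t\<close> and invariant
  under inversion of \<open>s\<close>.\<close>

definition theta_pair :: "complex \<Rightarrow> complex \<Rightarrow> complex" where
  "theta_pair s t = theta (s * t) * theta (s / t) / s"

lemma theta_pair_anti:
  assumes "s \<noteq> 0" "t \<noteq> 0"
  shows "theta_pair t s = - theta_pair s t"
proof -
  have "theta (t / s) = - theta (s / t) / (s / t)"
    using theta_inverse[of "s / t"] assms by simp
  hence *: "theta (t / s) / t = - (theta (s / t) / s)"
    using assms by (simp add: divide_simps)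
  have "theta_pair t s = theta (s * t) * (theta (t / s) / t)"
    by (simp add: theta_pair_def mult.commute)
  also have "\<dots> = - theta_pair s t"
    by (simp only: *) (simp add: theta_pair_def)
  finally show ?thesis .
qed

lemma qsym_theta_pair:
  assumes t: "t \<noteq> 0"
  shows "qsym (1 / q) 2 1 (\<lambda>s. theta_pair s t)"
proof -
  have rec: "theta_pair (q * s) t = 1 / q * s powi (- 2) * theta_pair s t" if s: "s \<noteq> 0" for s
  proof -
    have "theta (q * s * t) = - theta (s * t) / (s * t)" "theta (q * s / t) = - theta (s / t) / (s / t)"
      using theta_q[of "s * t"] theta_q[of "s / t"] s t by (simp_all add: mult.assoc)
    hence "theta_pair (q * s) t = (- theta (s * t) / (s * t)) * (- theta (s / t) / (s / t)) / (q * s)"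
      by (simp add: theta_pair_def)
    thus ?thesis using s t by (simp add: theta_pair_def power_int_minus power2_eq_square field_simps)
  qed
  have inv: "theta_pair (1 / s) t = 1 * theta_pair s t" if s: "s \<noteq> 0" for s
  proof -
    have "theta (1 / s * t) = - theta (s / t) / (s / t)" "theta (1 / s / t) = - theta (s * t) / (s * t)"
      using theta_inverse[of "s / t"] theta_inverse[of "s * t"] s t by simp_all
    hence "theta_pair (1 / s) t = (- theta (s / t) / (s / t)) * (- theta (s * t) / (s * t)) / (1 / s)"
      by (simp add: theta_pair_def)
    thus ?thesis using s t by (simp add: theta_pair_def field_simps)
  qed
  have "(\<lambda>s. theta_pair s t) holomorphic_on -{0}"
    unfolding theta_pair_def by (intro holomorphic_intros) (use t in auto)
  thus ?thesis
    using rec inv unfolding qsym_def quasi_def by blast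
qed

text \<open>Multiplying \<open>s\<close> by \<open>q\<close> shifts the argument
  \<open>s * s\<close> twice, whence degree 4. This factor carries the zeros at the square roots of
  powers of \<open>q\<close> and is the only odd one in \<open>Delta\<close>.\<close>

lemma qsym_theta_square: "qsym (q powi (- 2)) 4 (- 1) (\<lambda>s. theta (s * s) / s)"
proof -
  have rec: "theta (q * s * (q * s)) / (q * s) = q powi (- 2) * s powi (- 4) * (theta (s * s) / s)"
    if s: "s \<noteq> 0" for s
  proof -
    have "theta (q * s * (q * s)) = theta (q * (q * (s * s)))"
      by (simp add: mult_ac)
    also have "\<dots> = - (- theta (s * s) / (s * s)) / (q * (s * s))"
      using theta_q[of "s * s"] theta_q[of "q * (s * s)"] s by simp
    finally show ?thesis
      using s by (simp add: power_int_minus power2_eq_square power4_eq_xxxx field_simps)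
  qed
  have inv: "theta (1 / s * (1 / s)) / (1 / s) = - 1 * (theta (s * s) / s)" if s: "s \<noteq> 0" for s
    using theta_inverse[of "s * s"] s by (simp add: field_simps)
  have "(\<lambda>s. theta (s * s) / s) holomorphic_on -{0}"
    by (intro holomorphic_intros) auto
  thus ?thesis
    using rec inv unfolding qsym_def quasi_def by blast
qed

definition Delta :: "nat \<Rightarrow> (nat \<Rightarrow> complex) \<Rightarrow> complex" where
  "Delta n u = (\<Prod>j=1..n. theta (u j * u j) / u j) * (\<Prod>(j, k)\<in>pairs n. theta_pair (u j) (u k))"

lemma Delta_cong: "(\<And>k. k \<in> {1..n} \<Longrightarrow> u k = v k) \<Longrightarrow> Delta n u = Delta n v"
  unfolding Delta_def by (intro arg_cong2[where f = "(*)"] prod.cong) (auto simp: mem_pairs)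

lemma Delta_anti:
  assumes ij: "i \<in> {1..n}" "j \<in> {1..n}" "i \<noteq> j" and u: "\<And>k. k \<in> {1..n} \<Longrightarrow> u k \<noteq> 0"
  shows "Delta n (u \<circ> Transposition.transpose i j) = - Delta n u"
proof -
  have "(\<Prod>k=1..n. theta ((u \<circ> Transposition.transpose i j) k * (u \<circ> Transposition.transpose i j) k)
          / (u \<circ> Transposition.transpose i j) k) = (\<Prod>k=1..n. theta (u k * u k) / u k)"
    unfolding o_def by (rule prod.reindex_bij_betw[OF bij_betw_transpose[OF ij(1,2)]])
  moreover have "(\<Prod>(a, b)\<in>pairs n. theta_pair (u (Transposition.transpose i j a)) (u (Transposition.transpose i j b)))
      = - (\<Prod>(a, b)\<in>pairs n. theta_pair (u a) (u b))"
    by (rule prod_pairs_transpose[OF ij]) (rule theta_pair_anti; use u in simp)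
  ultimately show ?thesis by (simp add: Delta_def)
qed

text \<open>Degree count in one variable: 4 from \<open>theta (s * s) / s\<close> and 2 from each of
  the \<open>n - 1\<close> pairs containing \<open>i\<close>.\<close>

lemma qsym_Delta:
  assumes i: "i \<in> {1..n}" and u: "\<And>k. k \<in> {1..n} \<Longrightarrow> u k \<noteq> 0"
  shows "qsym (q powi (- int (n + 1))) (2 * int n + 2) (- 1) (\<lambda>s. Delta n (u(i := s)))"
proof -
  define I where "I = {p \<in> pairs n. fst p = i \<or> snd p = i}"
  have "qsym (\<Prod>j=1..n. if j = i then q powi (- 2) else 1) (\<Sum>j=1..n. if j = i then 4 else 0)
          (\<Prod>j=1..n. if j = i then - 1 else 1)
          (\<lambda>s. \<Prod>j=1..n. theta ((u(i := s)) j * (u(i := s)) j) / (u(i := s)) j)"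
  proof (rule qsym_prod)
    fix j assume "j \<in> {1..n}"
    show "qsym (if j = i then q powi (- 2) else 1) (if j = i then 4 else 0) (if j = i then - 1 else 1)
            (\<lambda>s. theta ((u(i := s)) j * (u(i := s)) j) / (u(i := s)) j)"
      using qsym_theta_square qsym_const by (cases "j = i") simp_all
  qed
  hence 1: "qsym (q powi (- 2)) 4 (- 1)
          (\<lambda>s. \<Prod>j=1..n. theta ((u(i := s)) j * (u(i := s)) j) / (u(i := s)) j)"
    using i by (simp add: prod.delta sum.delta)
  have "qsym (\<Prod>p\<in>pairs n. if fst p = i \<or> snd p = i then 1 / q else 1)
          (\<Sum>p\<in>pairs n. if fst p = i \<or> snd p = i then 2 else 0) (\<Prod>p\<in>pairs n. 1)
          (\<lambda>s. \<Prod>p\<in>pairs n. case p of (j, k) \<Rightarrow> theta_pair ((u(i := s)) j) ((u(i := s)) k))"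
  proof (rule qsym_prod)
    fix p assume "p \<in> pairs n"
    then obtain j k where p: "p = (j, k)" "j \<in> {1..n}" "k \<in> {1..n}" "j \<noteq> k"
      by (cases p) (auto simp: mem_pairs)
    have T2: "qsym (1 / q) 2 1 (\<lambda>s. theta_pair (u j) s)"
    proof -
      have "qsym (1 / q) 2 1 (\<lambda>s. (- 1) * theta_pair s (u j))"
        by (intro qsym_cmult qsym_theta_pair u p)
      moreover have eq: "(- 1) * theta_pair s (u j) = theta_pair (u j) s" if "s \<noteq> 0" for s
        using theta_pair_anti[of "u j" s] u[OF p(2)] that by simp
      ultimately show ?thesis
        by (rule qsym_transform)
    qed
    show "qsym (if fst p = i \<or> snd p = i then 1 / q else 1) (if fst p = i \<or> snd p = i then 2 else 0) 1
       (\<lambda>s. case p of (j, k) \<Rightarrow> theta_pair ((u(i := s)) j) ((u(i := s)) k))"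
      using p qsym_theta_pair[OF u[OF p(3)]] T2 qsym_const by auto
  qed
  moreover have "(\<Prod>p\<in>pairs n. if fst p = i \<or> snd p = i then 1 / q else 1) = (1 / q) ^ card I"
    by (simp add: prod.If_cases I_def Int_def)
  moreover have "(\<Sum>p\<in>pairs n. if fst p = i \<or> snd p = i then 2 else 0 :: int) = 2 * int (card I)"
    by (simp add: sum.If_cases I_def Int_def)
  moreover have "card I = n - 1"
    unfolding I_def by (rule card_pairs_incident[OF i])
  ultimately have 2: "qsym ((1 / q) ^ (n - 1)) (2 * int (n - 1)) 1
          (\<lambda>s. \<Prod>p\<in>pairs n. case p of (j, k) \<Rightarrow> theta_pair ((u(i := s)) j) ((u(i := s)) k))"
    by simp
  have n: "n \<ge> 1" using i by auto
  have "q powi (- 2) * (1 / q) ^ (n - 1) = q powi (- int (n + 1))"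
  proof -
    have "(1 / q) ^ (n - 1) = q powi (- int (n - 1))"
      by (simp add: power_int_minus field_simps)
    thus ?thesis using n by (simp flip: power_int_add add: of_nat_diff)
  qed
  moreover have "4 + 2 * int (n - 1) = 2 * int n + 2" using n by (simp add: of_nat_diff)
  ultimately show ?thesis
    using qsym_mult[OF 1 2] by (simp only: Delta_def mult_1_right)
qed

end

subsection \<open>Shifted factorials\<close>

text \<open>Upward steps divide by \<open>d\<close> at nonnegative indices, downward steps by
  \<open>e\<close> at negative ones. The asymmetry fits shifted factorials: a numerator factor may
  vanish at a nonnegative index, where the series terminates.\<close>

lemma int_recurrence_unique:
  fixes L R :: "int \<Rightarrow> 'a::field"
  assumes "L 0 = R 0"
    and L: "\<And>y. L (y + 1) * d y = L y * e y" and R: "\<And>y. R (y + 1) * d y = R y * e y"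
    and d: "\<And>y. 0 \<le> y \<Longrightarrow> d y \<noteq> 0" and e: "\<And>y. y < 0 \<Longrightarrow> e y \<noteq> 0"
  shows "L y = R y"
proof (induction y rule: int_induct[where k = 0])
  case base
  show ?case by fact
next
  case (step1 i)
  hence "L (i + 1) * d i = R (i + 1) * d i" using L R by simp
  thus ?case using d[of i] step1 by simp
next
  case (step2 i)
  hence "L (i - 1) * e (i - 1) = R (i - 1) * e (i - 1)"
    using L[of "i - 1"] R[of "i - 1"] by simp
  thus ?case using e[of "i - 1"] step2 by simp
qed

lemma summable_on_int_norm_power:
  fixes r :: real
  assumes "0 \<le> r" "r < 1"
  shows "(\<lambda>y::int. r ^ nat \<bar>y\<bar>) summable_on UNIV"
proof -
  have geo: "(\<lambda>k::nat. r ^ k) summable_on UNIV"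
    using assms by (intro norm_summable_imp_summable_on) (simp add: summable_geometric)
  have "(\<lambda>y::int. r ^ nat \<bar>y\<bar>) summable_on range int"
    using geo by (subst summable_on_reindex) (auto simp: o_def)
  moreover have "(\<lambda>y::int. r ^ nat \<bar>y\<bar>) summable_on range (\<lambda>k. - int k)"
    using geo by (subst summable_on_reindex) (auto simp: o_def inj_on_def)
  ultimately have "(\<lambda>y::int. r ^ nat \<bar>y\<bar>) summable_on (range int \<union> range (\<lambda>k. - int k))"
    by (rule summable_on_union)
  moreover have "range int \<union> range (\<lambda>k. - int k) = UNIV"
  proof -
    have "y \<in> range int \<union> range (\<lambda>k. - int k)" for y :: int
      by (cases y rule: int_cases2) auto
    thus ?thesis by blast
  qed
  ultimately show ?thesis by simp
qed

lemma qpoch_of_nat: "qpoch q a (int k) = (\<Prod>i<k. 1 - a * q ^ i)"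
  by (simp add: qpoch_def)

text \<open>If \<open>b\<close> or \<open>d\<close> is zero, both quotients are zero by the
  convention for division.\<close>

lemma quotient_cancel:
  fixes X :: "'a::field"
  assumes "X \<noteq> 0" "Y \<noteq> 0"
  shows "(a * P * (c * Q)) / (b * X * (d * Y)) * K * (X * Y) = (a * c) / (b * d) * K * (P * Q)"
  using assms by (cases "b = 0"; cases "d = 0") (auto simp: field_simps)

context nome
begin

lemma qpoch_well_definedD:
  assumes "\<And>l. qpoch_well_defined q a l" and "l < 0"
  shows "1 - a * q powi l \<noteq> 0"
proof -
  have "(\<Prod>i=1..nat (- l). 1 - a * q powi (- int i)) \<noteq> 0"
    using assms by (auto simp: qpoch_well_defined_def)
  hence "\<And>i. i \<in> {1..nat (- l)} \<Longrightarrow> 1 - a * q powi (- int i) \<noteq> 0"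
    by (simp add: prod_zero_iff)
  from this[of "nat (- l)"] show ?thesis using assms(2) by simp
qed

lemma qpoch_add_1:
  assumes wd: "\<And>l. qpoch_well_defined q a l"
  shows "qpoch q a (y + 1) = qpoch q a y * (1 - a * q powi y)"
proof (cases "0 \<le> y")
  case True
  then obtain k where y: "y = int k" by (metis nonneg_int_cases)
  show ?thesis
    using qpoch_of_nat[of q a k] qpoch_of_nat[of q a "Suc k"] by (simp add: y add.commute)
next
  case False
  define k where "k = nat (- y) - 1"
  have y: "y = - int (Suc k)" using False by (simp add: k_def)
  have "qpoch q a y = 1 / ((\<Prod>i=1..k. 1 - a * q powi (- int i)) * (1 - a * q powi y))"
    by (simp add: qpoch_def y nat_add_distrib del: of_nat_Suc)
  moreover have "qpoch q a (y + 1) = 1 / (\<Prod>i=1..k. 1 - a * q powi (- int i))"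
    by (cases "k = 0") (auto simp: qpoch_def y)
  moreover have "1 - a * q powi y \<noteq> 0"
    by (rule qpoch_well_definedD[OF wd]) (use False in simp)
  ultimately show ?thesis by simp
qed

text \<open>By \<open>qpoch_add_1\<close> the factor with index \<open>l\<close> divides the value
  at \<open>l + 1\<close>, so nonvanishing values exclude zero factors at all indices, the
  nonnegative ones included.\<close>

lemma qpoch_factor_nonzero:
  assumes wd: "\<And>l. qpoch_well_defined q a l" and nz: "\<And>l. qpoch q a l \<noteq> 0"
  shows "1 - a * q powi l \<noteq> 0"
  using qpoch_add_1[OF wd, of l] nz[of "l + 1"] by auto

lemma qpoch_0 [simp]: "qpoch q a 0 = 1"
  by (simp add: qpoch_def)

text \<open>Moves the index \<open>y\<close> into the argument \<open>z * q powi y\<close>, where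
  the inversion symmetry is visible, at the price of a Gaussian factor. Both sides obey the same
  first-order recurrence in \<open>y\<close> and agree at 0.\<close>

lemma qpoch_ratio_eq:
  assumes az: "a \<noteq> 0" "z \<noteq> 0"
    and wd: "\<And>l. qpoch_well_defined q (a * z) l" "\<And>l. qpoch_well_defined q (q * z / a) l"
    and nz: "\<And>l. qpoch q (q * z / a) l \<noteq> 0"
  shows "qpoch q (a * z) y / qpoch q (q * z / a) y * (qpoch_inf q (q * z / a) * qpoch_inf q (q / (a * z)))
    = (- a * z) powi y * q powi (y * (y - 1) div 2) *
      (qpoch_inf q (q * (z * q powi y) / a) * qpoch_inf q (q / (a * (z * q powi y))))"
    (is "?L y = ?R y")
proof (rule int_recurrence_unique[where L = ?L and R = ?R
      and d = "\<lambda>y. 1 - q * z / a * q powi y" and e = "\<lambda>y. 1 - a * z * q powi y"])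
  show "?L 0 = ?R 0" by simp
  show "1 - q * z / a * q powi y \<noteq> 0" for y
    by (rule qpoch_factor_nonzero[OF wd(2) nz])
  show "1 - a * z * q powi y \<noteq> 0" if "y < 0" for y
    by (rule qpoch_well_definedD[OF wd(1) that])
  show "?L (y + 1) * (1 - q * z / a * q powi y) = ?L y * (1 - a * z * q powi y)" for y
    using qpoch_factor_nonzero[OF wd(2) nz, of y] nz[of y]
    by (simp add: qpoch_add_1[OF wd(1)] qpoch_add_1[OF wd(2)] divide_simps)
  show "?R (y + 1) * (1 - q * z / a * q powi y) = ?R y * (1 - a * z * q powi y)" for y
  proof -
    define u where "u = z * q powi y"
    have u: "u \<noteq> 0" "z * q powi (y + 1) = q * u"
      using az by (auto simp: u_def power_int_add)
    have "(y + 1) * y div 2 = y * (y - 1) div 2 + y"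
    proof -
      have "(y + 1) * y = y * (y - 1) + y * 2" by (simp add: algebra_simps)
      thus ?thesis by simp
    qed
    hence 1: "q powi ((y + 1) * (y + 1 - 1) div 2) = q powi (y * (y - 1) div 2) * q powi y"
      by (simp add: power_int_add)
    have 2: "(- a * z) powi (y + 1) = (- a * z) powi y * (- a * z)"
      using az by (simp add: power_int_add)
    have 3: "qpoch_inf q (q * u / a) = (1 - q * u / a) * qpoch_inf q (q * (q * u) / a)"
      using qpoch_inf_rec[of "q * u / a"] by (simp add: mult_ac)
    have 4: "qpoch_inf q (q / (a * (q * u))) = (1 - 1 / (a * u)) * qpoch_inf q (q / (a * u))"
      using qpoch_inf_rec[of "1 / (a * u)"] by simp
    have 5: "(- a * z) * q powi y * (1 - 1 / (a * u)) = 1 - a * u"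
      using az u by (simp add: u_def field_simps)
    have "?R (y + 1) * (1 - q * u / a) =
      (- a * z) powi y * q powi (y * (y - 1) div 2) * ((- a * z) * q powi y * (1 - 1 / (a * u))) *
      (((1 - q * u / a) * qpoch_inf q (q * (q * u) / a)) * qpoch_inf q (q / (a * u)))"
      unfolding u(2) 1 2 4 by (simp only: mult_ac)
    also have "\<dots> = ?R y * (1 - a * u)"
      unfolding 5 3[symmetric] by (simp only: u_def mult_ac)
    finally show ?thesis by (simp add: u_def mult_ac)
  qed
qed

lemma qpoch_of_nat_q:
  "qpoch q (q * u) (int k) * (1 - u) = qpoch q u (int k) * (1 - q ^ k * u)"
proof -
  have "(1 - u) * qpoch q (q * u) (int k) = (\<Prod>i<Suc k. 1 - u * q ^ i)"
    by (simp add: qpoch_of_nat prod.lessThan_Suc_shift mult_ac del: prod.lessThan_Suc)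
  thus ?thesis by (simp add: qpoch_of_nat mult_ac)
qed

text \<open>The parameters above and below differ by the integral power \<open>q ^ m\<close>, so a
  quotient of length \<open>y\<close> can be exchanged for one of length \<open>m\<close>. The
  argument moves to \<open>z * q powi y\<close> and only a pure power of \<open>q\<close>
  remains.\<close>

lemma qpoch_quotient_eq:
  assumes cz: "c \<noteq> 0" "z \<noteq> 0"
    and wd: "\<And>l. qpoch_well_defined q (q ^ m * c * z) l" "\<And>l. qpoch_well_defined q (q * z / c) l"
      "\<And>l. qpoch_well_defined q (c * z) l" "\<And>l. qpoch_well_defined q (q powi (1 - int m) * z / c) l"
    and nz: "\<And>l. qpoch q (c * z) l \<noteq> 0" "\<And>l. qpoch q (q powi (1 - int m) * z / c) l \<noteq> 0"
  shows "(qpoch q (q ^ m * c * z) y * qpoch q (q * z / c) y) /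
      (qpoch q (c * z) y * qpoch q (q powi (1 - int m) * z / c) y) *
      (qpoch q (c * z) (int m) * qpoch q (c / z) (int m))
    = q powi (int m * y) * (qpoch q (c * (z * q powi y)) (int m) * qpoch q (c / (z * q powi y)) (int m))"
    (is "?L y = ?R y")
proof (rule int_recurrence_unique[where L = ?L and R = ?R
      and d = "\<lambda>y. (1 - c * z * q powi y) * (1 - q powi (1 - int m) * z / c * q powi y)"
      and e = "\<lambda>y. (1 - q ^ m * c * z * q powi y) * (1 - q * z / c * q powi y)"])
  show "?L 0 = ?R 0" using nz[of 0] by simp
  show "(1 - c * z * q powi y) * (1 - q powi (1 - int m) * z / c * q powi y) \<noteq> 0" for y
    using qpoch_factor_nonzero[OF wd(3) nz(1)] qpoch_factor_nonzero[OF wd(4) nz(2)] by simp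
  show "(1 - q ^ m * c * z * q powi y) * (1 - q * z / c * q powi y) \<noteq> 0" if "y < 0" for y
    using qpoch_well_definedD[OF wd(1) that] qpoch_well_definedD[OF wd(2) that] by simp
  show "?L (y + 1) * ((1 - c * z * q powi y) * (1 - q powi (1 - int m) * z / c * q powi y))
      = ?L y * ((1 - q ^ m * c * z * q powi y) * (1 - q * z / c * q powi y))" for y
    using qpoch_factor_nonzero[OF wd(3) nz(1), of y] qpoch_factor_nonzero[OF wd(4) nz(2), of y]
    unfolding qpoch_add_1[OF wd(1)] qpoch_add_1[OF wd(2)] qpoch_add_1[OF wd(3)] qpoch_add_1[OF wd(4)]
    by (rule quotient_cancel)
  show "?R (y + 1) * ((1 - c * z * q powi y) * (1 - q powi (1 - int m) * z / c * q powi y))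
      = ?R y * ((1 - q ^ m * c * z * q powi y) * (1 - q * z / c * q powi y))" for y
  proof -
    define u where "u = z * q powi y"
    \<comment> \<open>The value of \<open>c / u\<close> after the step from \<open>y\<close> to
      \<open>y + 1\<close>.\<close>
    define v where "v = c / (q * u)"
    have u: "u \<noteq> 0" "z * q powi (y + 1) = q * u"
      using cz by (auto simp: u_def power_int_add)
    have v: "v \<noteq> 0" "q * v = c / u" using cz u by (auto simp: v_def)
    have 1: "qpoch q (c * (q * u)) (int m) * (1 - c * u) = qpoch q (c * u) (int m) * (1 - q ^ m * c * u)"
      using qpoch_of_nat_q[of "c * u" m] by (simp add: mult_ac)
    have 2: "q ^ m * (qpoch q v (int m) * (1 - q powi (1 - int m) * u / c)) =
        qpoch q (c / u) (int m) * (1 - q * u / c)"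
    proof -
      have E1: "q ^ m * (1 - q powi (1 - int m) * u / c) = - (1 - q ^ m * v) / v"
        using cz u by (simp add: v_def power_int_diff field_simps)
      have E2: "1 - q * u / c = - (1 - v) / v"
        using cz u by (simp add: v_def field_simps)
      have "q ^ m * (qpoch q v (int m) * (1 - q powi (1 - int m) * u / c))
          = qpoch q v (int m) * (q ^ m * (1 - q powi (1 - int m) * u / c))"
        by (simp only: mult_ac)
      also have "\<dots> = - (qpoch q v (int m) * (1 - q ^ m * v)) / v"
        unfolding E1 by (simp only: mult_minus_right times_divide_eq_right)
      also have "\<dots> = qpoch q (q * v) (int m) * (- (1 - v) / v)"
        unfolding qpoch_of_nat_q[symmetric] by (simp only: mult_minus_right times_divide_eq_right)
      finally show ?thesis unfolding E2 v(2) .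
    qed
    have 3: "q powi (int m * (y + 1)) = q powi (int m * y) * q ^ m"
      by (simp add: power_int_add distrib_left)
    have "?R (y + 1) * ((1 - c * u) * (1 - q powi (1 - int m) * u / c)) =
       q powi (int m * y) * (qpoch q (c * (q * u)) (int m) * (1 - c * u)) *
        (q ^ m * (qpoch q v (int m) * (1 - q powi (1 - int m) * u / c)))"
      unfolding 3 u(2) v_def by (simp only: mult_ac)
    also have "\<dots> = ?R y * ((1 - q ^ m * c * u) * (1 - q * u / c))"
      unfolding 1 2 by (simp only: u_def mult_ac)
    finally show ?thesis by (simp add: u_def mult_ac)
  qed
qed

text \<open>The infinite product on the left grows like an inverse Gaussian in \<open>k\<close>;
  with its prefactor it becomes a finite product that is bounded uniformly in \<open>k\<close>. This
  drives the convergence estimate.\<close>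

lemma qpoch_inf_reflect:
  assumes "x \<noteq> 0"
  shows "(- x) ^ k * q powi (int k * (int k - 1) div 2) * qpoch_inf q (q / (x * q ^ k))
    = qpoch q x (int k) * qpoch_inf q (q / x)"
proof (induction k)
  case 0
  thus ?case by simp
next
  case (Suc k)
  have "int (Suc k) * (int (Suc k) - 1) div 2 = int k * (int k - 1) div 2 + int k"
  proof -
    have "int (Suc k) * (int (Suc k) - 1) = int k * (int k - 1) + int k * 2" by (simp add: algebra_simps)
    thus ?thesis by simp
  qed
  hence 1: "q powi (int (Suc k) * (int (Suc k) - 1) div 2) = q powi (int k * (int k - 1) div 2) * q ^ k"
    by (simp add: power_int_add)
  have 2: "qpoch_inf q (q / (x * q ^ Suc k)) = (1 - 1 / (x * q ^ k)) * qpoch_inf q (q / (x * q ^ k))"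
    using qpoch_inf_rec[of "1 / (x * q ^ k)"] by (simp add: mult_ac)
  have 3: "(- x) * q ^ k * (1 - 1 / (x * q ^ k)) = 1 - x * q ^ k"
    using assms by (simp add: field_simps)
  have "(- x) ^ Suc k * q powi (int (Suc k) * (int (Suc k) - 1) div 2) * qpoch_inf q (q / (x * q ^ Suc k))
      = ((- x) * q ^ k * (1 - 1 / (x * q ^ k))) *
        ((- x) ^ k * q powi (int k * (int k - 1) div 2) * qpoch_inf q (q / (x * q ^ k)))"
    unfolding 1 2 by (simp only: power_Suc mult_ac)
  also have "\<dots> = qpoch q x (int (Suc k)) * qpoch_inf q (q / x)"
    unfolding 3 Suc by (simp only: qpoch_of_nat prod.lessThan_Suc mult_ac)
  finally show ?case .
qed

end

lemma prod_power_int: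
  fixes f :: "'a \<Rightarrow> 'b::field"
  shows "(\<Prod>i\<in>I. f i powi k) = (\<Prod>i\<in>I. f i) powi k"
  by (induction I rule: infinite_finite_induct) (auto simp: power_int_mult_distrib)

subsection \<open>Bilateral averages\<close>

locale kernel = nome +
  fixes n p :: nat and m :: "nat \<Rightarrow> nat" and a c :: "nat \<Rightarrow> complex"
  assumes a_nz: "j \<in> {1..2*n+2} \<Longrightarrow> a j \<noteq> 0"
    and conv: "norm (q powi (1 - int (\<Sum>j=1..p. m j)) / (\<Prod>j=1..2*n+2. a j)) < 1"
begin

definition rho :: complex where
  "rho = q powi (1 - int (\<Sum>j=1..p. m j)) / (\<Prod>j=1..2*n+2. a j)"

text \<open>The normalising factor of one variable: its two products are those occurring in the last
  two prefactors of the identity. It is invariant under inversion of \<open>u\<close>.\<close>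

definition H :: "complex \<Rightarrow> complex" where
  "H u = (\<Prod>j=1..2*n+2. qpoch_inf q (q * u / a j) * qpoch_inf q (q / (a j * u))) *
     (\<Prod>j=1..p. qpoch q (c j * u) (int (m j)) * qpoch q (c j / u) (int (m j)))"

text \<open>The weight makes \<open>\<Sum>y. weight z y * f (z * q powi y)\<close> quasi-periodic of degree \<open>2n + 2\<close> for
  every \<open>f\<close>. The parameter \<open>A\<close> of the series is hidden in the growth of \<open>H (z * q powi y)\<close>.\<close>

definition weight :: "complex \<Rightarrow> int \<Rightarrow> complex" where
  "weight z y = z powi ((2 * int n + 2) * y) * q powi ((int n + 1) * y\<^sup>2)"

text \<open>The one-variable constituents of the Weyl denominator divided by the \<open>n\<close>-th
  powers of its variables; \<open>1 / u - u\<close> makes them odd, powers of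
  \<open>u + 1 / u\<close> are even.\<close>

definition psi :: "nat \<Rightarrow> complex \<Rightarrow> complex" where
  "psi e u = (1 / u - u) * (u + 1 / u) ^ e"

definition kernel_term :: "nat \<Rightarrow> complex \<Rightarrow> int \<Rightarrow> complex" where
  "kernel_term e z y = weight z y * psi e (z * q powi y) * H (z * q powi y)"

lemma H_inverse: "H (1 / u) = H u"
proof -
  have "(\<Prod>j=1..2*n+2. qpoch_inf q (q * (1 / u) / a j) * qpoch_inf q (q / (a j * (1 / u))))
      = (\<Prod>j=1..2*n+2. qpoch_inf q (q * u / a j) * qpoch_inf q (q / (a j * u)))"
    by (intro prod.cong) (auto simp: mult_ac)
  moreover have "(\<Prod>j=1..p. qpoch q (c j * (1 / u)) (int (m j)) * qpoch q (c j / (1 / u)) (int (m j)))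
      = (\<Prod>j=1..p. qpoch q (c j * u) (int (m j)) * qpoch q (c j / u) (int (m j)))"
    by (intro prod.cong) (auto simp: mult_ac)
  ultimately show ?thesis by (simp only: H_def)
qed

lemma psi_inverse: "psi e (1 / u) = - psi e u"
proof -
  have "psi e (1 / u) = (u - 1 / u) * (u + 1 / u) ^ e"
    by (simp add: psi_def add.commute)
  also have "\<dots> = - psi e u" by (simp only: psi_def) (simp flip: mult_minus_left)
  finally show ?thesis .
qed

text \<open>Inverting \<open>z\<close> and negating \<open>y\<close> fixes the weight and inverts
  \<open>z * q powi y\<close>. Besides the oddness of the average, this yields the estimates for
  negative \<open>y\<close> from those for positive \<open>y\<close>.\<close>

lemma kernel_term_inverse: "kernel_term e (1 / z) (- y) = - kernel_term e z y"
proof -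
  have 1: "1 / z * q powi (- y) = 1 / (z * q powi y)"
    by (simp add: power_int_minus divide_simps)
  have 2: "weight (1 / z) (- y) = weight z y"
    by (simp add: weight_def power_int_minus power_int_divide_distrib)
  show ?thesis
    by (simp only: kernel_term_def 1 2 H_inverse psi_inverse) simp
qed

lemma kernel_term_q:
  assumes "z \<noteq> 0"
  shows "kernel_term e (q * z) y = q powi (- int (n + 1)) * z powi (- (2 * int n + 2)) * kernel_term e z (y + 1)"
proof -
  have 1: "q * z * q powi y = z * q powi (y + 1)"
    by (simp add: power_int_add)
  have 2: "weight (q * z) y = q powi (- int (n + 1)) * z powi (- (2 * int n + 2)) * weight z (y + 1)"
  proof -
    have "(2 * int n + 2) * y = - (2 * int n + 2) + (2 * int n + 2) * (y + 1)" 
      by (simp add: algebra_simps)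
    hence z: "z powi ((2 * int n + 2) * y) = z powi (- (2 * int n + 2)) * z powi ((2 * int n + 2) * (y + 1))"
      using assms by (metis power_int_add)
    have "(2 * int n + 2) * y + (int n + 1) * y\<^sup>2 = - int (n + 1) + (int n + 1) * (y + 1)\<^sup>2"
      by (simp add: algebra_simps power2_eq_square)
    hence q: "q powi ((2 * int n + 2) * y) * q powi ((int n + 1) * y\<^sup>2)
        = q powi (- int (n + 1)) * q powi ((int n + 1) * (y + 1)\<^sup>2)"
      by (metis power_int_add q_nz)
    have "weight (q * z) y = z powi ((2 * int n + 2) * y) *
        (q powi ((2 * int n + 2) * y) * q powi ((int n + 1) * y\<^sup>2))"
      by (simp only: weight_def power_int_mult_distrib mult_ac)
    thus ?thesis unfolding z q by (simp only: weight_def mult_ac)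
  qed
  show ?thesis unfolding kernel_term_def 1 2 by (simp only: mult_ac)
qed

text \<open>The place where the value of \<open>rho\<close> matters: its denominator cancels the
  product of the \<open>a j\<close>, its numerator supplies \<open>(1 - M) * y\<close>, and
  \<open>(n + 1) * y * (y - 1) + M * y + (1 - M) * y + n * y\<close> equals
  \<open>(n + 1) * y^2\<close>.\<close>

lemma weight_eq:
  assumes z: "z \<noteq> 0"
  shows "(\<Prod>j=1..2*n+2. (- a j * z) powi y * q powi (y * (y - 1) div 2)) *
      (\<Prod>j=1..p. q powi (int (m j) * y)) * rho powi y * q powi (int n * y) = weight z y"
proof -
  define A where "A = (\<Prod>j=1..2*n+2. a j)"
  have A: "A \<noteq> 0" using a_nz by (auto simp: A_def)
  define M where "M = int (\<Sum>j=1..p. m j)"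
  have "(\<Prod>j=1..2*n+2. - a j * z) = (\<Prod>j=1..2*n+2. (- z) * a j)"
    by (simp add: mult.commute)
  also have "\<dots> = (- z) ^ (2*n+2) * A"
    by (simp only: prod.distrib A_def prod_constant) simp
  also have "(- z) ^ (2*n+2) = z powi (2 * int n + 2)"
  proof -
    have "(- z) ^ (2*n+2) = z ^ (2*n+2)" by (rule power_minus_even) simp
    also have "\<dots> = z powi int (2*n+2)" by (simp only: power_int_of_nat)
    also have "int (2*n+2) = 2 * int n + 2" by simp
    finally show ?thesis .
  qed
  finally have "(\<Prod>j=1..2*n+2. (- a j * z) powi y) = (z powi (2 * int n + 2) * A) powi y"
    by (simp only: prod_power_int)
  hence 1: "(\<Prod>j=1..2*n+2. (- a j * z) powi y) = z powi ((2 * int n + 2) * y) * A powi y"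
    by (simp only: power_int_mult_distrib power_int_mult)
  have 2: "(\<Prod>j=1..2*n+2. q powi (y * (y - 1) div 2)) = q powi ((int n + 1) * (y * (y - 1)))"
  proof -
    have "(\<Prod>j=1..2*n+2. q powi (y * (y - 1) div 2)) = (q powi (y * (y - 1) div 2)) powi int (2*n+2)"
      by (simp only: prod_constant power_int_of_nat) simp
    also have "\<dots> = q powi ((y * (y - 1) div 2) * int (2*n+2))"
      by (simp only: power_int_mult)
    also have "(y * (y - 1) div 2) * int (2*n+2) = (int n + 1) * (y * (y - 1))"
    proof -
      have "even (y * (y - 1))" by simp
      then obtain k where "y * (y - 1) = 2 * k" by (rule evenE)
      thus ?thesis by (simp add: algebra_simps)
    qed
    finally show ?thesis .
  qed
  have 3: "(\<Prod>j=1..p. q powi (int (m j) * y)) = q powi (M * y)"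
  proof -
    have "(\<Prod>j=1..k. q powi (int (m j) * y)) = q powi (int (\<Sum>j=1..k. m j) * y)" for k
      by (induction k) (auto simp: power_int_add distrib_right)
    thus ?thesis by (simp only: M_def)
  qed
  have 4: "rho powi y * A powi y = q powi ((1 - M) * y)"
  proof -
    have "rho = q powi (1 - M) / A" by (simp only: rho_def A_def M_def)
    thus ?thesis using A by (simp add: power_int_divide_distrib power_int_mult)
  qed
  have 5: "q powi ((int n + 1) * (y * (y - 1))) * q powi (M * y) * q powi ((1 - M) * y) * q powi (int n * y)
      = q powi ((int n + 1) * y\<^sup>2)"
  proof -
    have "(int n + 1) * (y * (y - 1)) + M * y + (1 - M) * y + int n * y = (int n + 1) * y\<^sup>2"
      by (simp add: algebra_simps power2_eq_square)
    thus ?thesis by (simp flip: power_int_add)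
  qed
  have "(\<Prod>j=1..2*n+2. (- a j * z) powi y * q powi (y * (y - 1) div 2)) *
      (\<Prod>j=1..p. q powi (int (m j) * y)) * rho powi y * q powi (int n * y)
     = z powi ((2 * int n + 2) * y) * (q powi ((int n + 1) * (y * (y - 1))) * q powi (M * y) *
        (rho powi y * A powi y) * q powi (int n * y))"
    unfolding prod.distrib 1 2 3 by (simp only: mult_ac)
  also have "\<dots> = weight z y"
    unfolding 4 5 by (simp only: weight_def)
  finally show ?thesis .
qed

text \<open>Collects all factors of the summand that belong to one variable;
  \<open>q powi (int n * y)\<close> is the contribution of the \<open>n\<close>-th powers contained
  in \<open>W\<close>.\<close>

lemma series_factor_eq:
  assumes z: "z \<noteq> 0" and c_nz: "\<And>j. j \<in> {1..p} \<Longrightarrow> c j \<noteq> 0"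
    and wdc: "\<And>j l. j \<in> {1..p} \<Longrightarrow>
        qpoch_well_defined q (q ^ m j * c j * z) l \<and>
        qpoch_well_defined q (q * z / c j) l \<and>
        qpoch_well_defined q (c j * z) l \<and>
        qpoch_well_defined q (q powi (1 - int (m j)) * z / c j) l \<and>
        qpoch q (c j * z) l \<noteq> 0 \<and>
        qpoch q (q powi (1 - int (m j)) * z / c j) l \<noteq> 0"
    and wda: "\<And>j l. j \<in> {1..2*n+2} \<Longrightarrow>
        qpoch_well_defined q (a j * z) l \<and>
        qpoch_well_defined q (q * z / a j) l \<and>
        qpoch q (q * z / a j) l \<noteq> 0"
  shows "(\<Prod>j=1..p. (qpoch q (q ^ m j * c j * z) y * qpoch q (q * z / c j) y) /
        (qpoch q (c j * z) y * qpoch q (q powi (1 - int (m j)) * z / c j) y)) *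
      (\<Prod>j=1..2*n+2. qpoch q (a j * z) y / qpoch q (q * z / a j) y) *
      rho powi y * q powi (int n * y) * H z = weight z y * H (z * q powi y)"
proof -
  have C: "(\<Prod>j=1..p. (qpoch q (q ^ m j * c j * z) y * qpoch q (q * z / c j) y) /
        (qpoch q (c j * z) y * qpoch q (q powi (1 - int (m j)) * z / c j) y)) *
      (\<Prod>j=1..p. qpoch q (c j * z) (int (m j)) * qpoch q (c j / z) (int (m j)))
     = (\<Prod>j=1..p. q powi (int (m j) * y)) *
       (\<Prod>j=1..p. qpoch q (c j * (z * q powi y)) (int (m j)) * qpoch q (c j / (z * q powi y)) (int (m j)))"
    unfolding prod.distrib[symmetric]
    by (intro prod.cong refl qpoch_quotient_eq) (use z c_nz wdc in blast)+
  have A: "(\<Prod>j=1..2*n+2. qpoch q (a j * z) y / qpoch q (q * z / a j) y) *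
      (\<Prod>j=1..2*n+2. qpoch_inf q (q * z / a j) * qpoch_inf q (q / (a j * z)))
     = (\<Prod>j=1..2*n+2. (- a j * z) powi y * q powi (y * (y - 1) div 2)) *
       (\<Prod>j=1..2*n+2. qpoch_inf q (q * (z * q powi y) / a j) * qpoch_inf q (q / (a j * (z * q powi y))))"
    unfolding prod.distrib[symmetric]
    by (intro prod.cong refl qpoch_ratio_eq) (use z a_nz wda in blast)+
  have rearrange: "X * Y * r * s * (V * U) = (Y * V) * (X * U) * r * s" for X Y r s U V :: complex
    by (simp only: mult_ac)
  have rearrange': "(X * V) * (Y * U) * r * s = (X * Y * r * s) * (V * U)" for X Y r s U V :: complex
    by (simp only: mult_ac)
  show ?thesis
    unfolding H_def rearrange A C unfolding rearrange' weight_eq[OF z] ..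
qed

text \<open>Grouped for the estimate: apart from \<open>rho ^ k\<close>, every group stays bounded
  in \<open>k\<close>. The Gaussian is absorbed by \<open>qpoch_inf_reflect\<close>,
  \<open>q ^ (n * k)\<close> tames \<open>psi\<close>, and \<open>q ^ (m j * k)\<close> tames the
  factors with \<open>c j / (z * q ^ k)\<close>.\<close>

lemma kernel_term_of_nat_eq:
  assumes z: "z \<noteq> 0"
  shows "kernel_term e z (int k) = rho ^ k * (q ^ (n * k) * psi e (z * q ^ k)) *
    (\<Prod>j=1..2*n+2. qpoch_inf q (q * (z * q ^ k) / a j) * (qpoch q (a j * z) (int k) * qpoch_inf q (q / (a j * z)))) *
    (\<Prod>j=1..p. qpoch q (c j * (z * q ^ k)) (int (m j)) *
       (q ^ (m j * k) * qpoch q (c j / (z * q ^ k)) (int (m j))))"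
proof -
  have A: "(\<Prod>j=1..2*n+2. qpoch_inf q (q * (z * q ^ k) / a j) * (qpoch q (a j * z) (int k) * qpoch_inf q (q / (a j * z))))
     = (\<Prod>j=1..2*n+2. (- a j * z) powi int k * q powi (int k * (int k - 1) div 2)) *
       (\<Prod>j=1..2*n+2. qpoch_inf q (q * (z * q ^ k) / a j) * qpoch_inf q (q / (a j * (z * q ^ k))))"
    unfolding prod.distrib[symmetric]
  proof (rule prod.cong[OF refl])
    fix j assume "j \<in> {1..2*n+2}"
    hence "a j * z \<noteq> 0" using a_nz z by auto
    from qpoch_inf_reflect[OF this, of k]
    show "qpoch_inf q (q * (z * q ^ k) / a j) * (qpoch q (a j * z) (int k) * qpoch_inf q (q / (a j * z)))
       = (- a j * z) powi int k * q powi (int k * (int k - 1) div 2) *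
         (qpoch_inf q (q * (z * q ^ k) / a j) * qpoch_inf q (q / (a j * (z * q ^ k))))"
      by (simp add: mult_ac)
  qed
  have C: "(\<Prod>j=1..p. qpoch q (c j * (z * q ^ k)) (int (m j)) *
       (q ^ (m j * k) * qpoch q (c j / (z * q ^ k)) (int (m j))))
     = (\<Prod>j=1..p. q powi (int (m j) * int k)) *
       (\<Prod>j=1..p. qpoch q (c j * (z * q ^ k)) (int (m j)) * qpoch q (c j / (z * q ^ k)) (int (m j)))"
    unfolding prod.distrib[symmetric]
    by (intro prod.cong refl) (simp only: mult_ac flip: of_nat_mult power_int_of_nat)
  have pw: "q powi (int n * int k) = q ^ (n * k)" "rho powi int k = rho ^ k" "q powi int k = q ^ k"
    by (simp_all only: power_int_of_nat flip: of_nat_mult)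
  have rearrange: "r * (s * u) * (X * V) * (Y * U) = (X * Y * r * s) * u * (V * U)" for X Y r s u U V :: complex
    by (simp only: mult_ac)
  show ?thesis
    unfolding A C rearrange unfolding weight_eq[OF z, of "int k", unfolded pw]
    by (simp only: kernel_term_def H_def pw)
qed

lemma kernel_term_of_nat_bound:
  assumes R: "R \<ge> 1" and e: "e < n"
  shows "\<exists>M\<ge>0. \<forall>z k. 1 / R \<le> norm z \<and> norm z \<le> R \<longrightarrow> norm (kernel_term e z (int k)) \<le> M * norm rho ^ k"
proof -
  define Q where "Q = 1 - norm q"
  have Q: "Q > 0" using norm_q by (simp add: Q_def)
  have em: "exp (x / Q) \<le> exp (y / Q)" if "x \<le> y" for x y
    using that Q by (simp add: divide_right_mono)
  define Ka where "Ka j = exp (R / norm (a j) / Q) * (exp (norm (a j) * R / Q) * exp (R / norm (a j) / Q))" for j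
  define Kc where "Kc j = exp (norm (c j) * R / Q) * (1 + norm (c j) * R) ^ m j" for j
  define M where "M = (2 * R) ^ (e + 1) * (\<Prod>j=1..2*n+2. Ka j) * (\<Prod>j=1..p. Kc j)"
  have "norm (kernel_term e z (int k)) \<le> M * norm rho ^ k" if z: "1 / R \<le> norm z" "norm z \<le> R" for z k
  proof -
    have "0 < 1 / R" using R by simp
    hence z0: "z \<noteq> 0" using z by auto
    have iz: "norm (1 / z) \<le> R"
      using z z0 R by (simp add: norm_divide divide_simps mult.commute)
    have qk: "norm (q ^ k) \<le> 1" for k
      using norm_q by (simp add: norm_power power_le_one)
    have zq: "norm (z * q ^ k) \<le> R"
      using mult_mono[OF z(2) qk[of k]] R by (simp add: norm_mult)
    have 1: "norm (q ^ (n * k) * psi e (z * q ^ k)) \<le> (2 * R) ^ (e + 1)"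
    proof -
      \<comment> \<open>\<open>psi e\<close> has \<open>e + 1\<close> factors, each growing like
        \<open>1 / q ^ k\<close>. As \<open>e < n\<close>, each of them can be given one factor
        \<open>q ^ k\<close>, with \<open>n - 1 - e\<close> left over.\<close>
      have "q ^ (n * k) = q ^ ((n - 1 - e) * k) * (q ^ k * (q ^ k) ^ e)"
      proof -
        obtain d where d: "n = Suc (e + d)" using e less_imp_Suc_add by blast
        hence "n * k = (n - 1 - e) * k + (k + k * e)" by (simp add: algebra_simps)
        thus ?thesis by (simp only: power_add power_mult)
      qed
      hence "q ^ (n * k) * psi e (z * q ^ k) =
          q ^ ((n - 1 - e) * k) * (q ^ k * (1 / (z * q ^ k) - z * q ^ k)) * (q ^ k * (z * q ^ k + 1 / (z * q ^ k))) ^ e"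
        by (simp only: psi_def power_mult_distrib mult_ac)
      also have "q ^ k * (1 / (z * q ^ k) - z * q ^ k) = 1 / z - z * q ^ k * q ^ k"
        using z0 by (simp add: field_simps)
      also have "q ^ k * (z * q ^ k + 1 / (z * q ^ k)) = 1 / z + z * q ^ k * q ^ k"
        using z0 by (simp add: field_simps)
      finally have eq: "q ^ (n * k) * psi e (z * q ^ k) =
          q ^ ((n - 1 - e) * k) * (1 / z - z * q ^ k * q ^ k) * (1 / z + z * q ^ k * q ^ k) ^ e" .
      have zqq: "norm (z * q ^ k * q ^ k) \<le> R"
        using mult_mono[OF zq qk[of k]] R by (simp add: norm_mult)
      have "norm (1 / z - z * q ^ k * q ^ k) \<le> 2 * R"
        using norm_triangle_ineq4[of "1 / z" "z * q ^ k * q ^ k"] zqq iz by linarith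
      moreover have "norm ((1 / z + z * q ^ k * q ^ k) ^ e) \<le> (2 * R) ^ e"
        unfolding norm_power
        using norm_triangle_ineq[of "1 / z" "z * q ^ k * q ^ k"] zqq iz by (intro power_mono) auto
      ultimately have "norm (q ^ (n * k) * psi e (z * q ^ k)) \<le> 1 * (2 * R) * (2 * R) ^ e"
        unfolding eq norm_mult[of "_ * _" "_ ^ e"] norm_mult[of "q ^ _" "_ - _"]
        using qk R by (intro mult_mono) auto
      thus ?thesis by simp
    qed
    have 2: "norm (\<Prod>j=1..2*n+2. qpoch_inf q (q * (z * q ^ k) / a j) *
          (qpoch q (a j * z) (int k) * qpoch_inf q (q / (a j * z)))) \<le> (\<Prod>j=1..2*n+2. Ka j)"
      unfolding prod_norm[symmetric]
    proof (intro prod_mono conjI norm_ge_zero)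
      fix j assume j: "j \<in> {1..2*n+2}"
      have aj: "norm (a j) > 0" using a_nz[OF j] by simp
      have b1: "norm (qpoch_inf q (q * (z * q ^ k) / a j)) \<le> exp (R / norm (a j) / Q)"
      proof -
        have "norm (q * (z * q ^ k) / a j) \<le> R / norm (a j)"
          using mult_mono[OF qk[of 1] zq] R aj by (simp add: norm_divide norm_mult divide_right_mono)
        from em[OF this] show ?thesis
          using norm_qpoch_inf_le unfolding Q_def by (rule order_trans[rotated])
      qed
      have b2: "norm (qpoch q (a j * z) (int k)) \<le> exp (norm (a j) * R / Q)"
      proof -
        have "exp (norm (a j * z) / Q) \<le> exp (norm (a j) * R / Q)"
          by (rule em) (simp add: z norm_mult mult_left_mono)
        thus ?thesis using norm_qpoch_prod_le[of "a j * z" k] unfolding Q_def qpoch_of_nat by linarith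
      qed
      have b3: "norm (qpoch_inf q (q / (a j * z))) \<le> exp (R / norm (a j) / Q)"
      proof -
        have "norm (q / (a j * z)) = norm q * norm (1 / z) / norm (a j)"
          by (simp add: norm_divide norm_mult)
        also have "\<dots> \<le> R / norm (a j)"
          using mult_mono[OF qk[of 1] iz] R aj by (simp add: divide_right_mono)
        finally have "norm (q / (a j * z)) \<le> R / norm (a j)" .
        from em[OF this] show ?thesis
          using norm_qpoch_inf_le unfolding Q_def by (rule order_trans[rotated])
      qed
      show "norm (qpoch_inf q (q * (z * q ^ k) / a j) *
          (qpoch q (a j * z) (int k) * qpoch_inf q (q / (a j * z)))) \<le> Ka j"
        unfolding norm_mult[of "qpoch_inf _ _"] norm_mult[of "qpoch _ _ _"] Ka_def
        by (intro mult_mono b1 b2 b3) auto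
    qed
    have 3: "norm (\<Prod>j=1..p. qpoch q (c j * (z * q ^ k)) (int (m j)) *
       (q ^ (m j * k) * qpoch q (c j / (z * q ^ k)) (int (m j)))) \<le> (\<Prod>j=1..p. Kc j)"
      unfolding prod_norm[symmetric]
    proof (intro prod_mono conjI norm_ge_zero)
      fix j
      have b1: "norm (qpoch q (c j * (z * q ^ k)) (int (m j))) \<le> exp (norm (c j) * R / Q)"
      proof -
        have "exp (norm (c j * (z * q ^ k)) / Q) \<le> exp (norm (c j) * R / Q)"
          by (rule em) (use mult_left_mono[OF zq, of "norm (c j)"] in \<open>simp add: norm_mult\<close>)
        thus ?thesis using norm_qpoch_prod_le[of "c j * (z * q ^ k)" "m j"] unfolding Q_def qpoch_of_nat by linarith
      qed
      \<comment> \<open>One factor \<open>q ^ k\<close> goes to each of the \<open>m j\<close>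
        factors and clears the denominator there.\<close>
      have "q ^ (m j * k) * qpoch q (c j / (z * q ^ k)) (int (m j)) = (\<Prod>i<m j. q ^ k - c j * (1 / z) * q ^ i)"
      proof -
        have "q ^ (m j * k) = (\<Prod>i<m j. q ^ k)" by (simp add: power_mult mult.commute)
        thus ?thesis
          unfolding qpoch_of_nat prod.distrib[symmetric]
          using z0 by (simp only: prod.distrib[symmetric]) (intro prod.cong refl, simp add: field_simps)
      qed
      also have "norm \<dots> \<le> (\<Prod>i<m j. 1 + norm (c j) * R)"
        unfolding prod_norm[symmetric]
      proof (intro prod_mono conjI norm_ge_zero)
        fix i
        have "norm (c j * (1 / z) * q ^ i) \<le> norm (c j) * R * 1"
          unfolding norm_mult[of _ "q ^ i"] norm_mult[of "c j"]
          using iz qk R by (intro mult_mono) auto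
        thus "norm (q ^ k - c j * (1 / z) * q ^ i) \<le> 1 + norm (c j) * R"
          using norm_triangle_ineq4[of "q ^ k" "c j * (1 / z) * q ^ i"] qk[of k] by linarith
      qed
      finally have b2: "norm (q ^ (m j * k) * qpoch q (c j / (z * q ^ k)) (int (m j))) \<le> (1 + norm (c j) * R) ^ m j"
        by simp
      show "norm (qpoch q (c j * (z * q ^ k)) (int (m j)) *
          (q ^ (m j * k) * qpoch q (c j / (z * q ^ k)) (int (m j)))) \<le> Kc j"
        unfolding norm_mult[of "qpoch _ _ _"] Kc_def by (intro mult_mono b1 b2) auto
    qed
    have "norm (kernel_term e z (int k)) \<le> norm rho ^ k * (2 * R) ^ (e + 1) * (\<Prod>j=1..2*n+2. Ka j) * (\<Prod>j=1..p. Kc j)"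
      unfolding kernel_term_of_nat_eq[OF z0] norm_mult[of _ "prod _ _"] norm_mult[of "rho ^ k"] norm_power[of rho]
      using R by (intro mult_mono 1 2 3 mult_nonneg_nonneg prod_nonneg) (auto simp: Ka_def)
    thus ?thesis by (simp add: M_def mult_ac)
  qed
  moreover have "M \<ge> 0"
    unfolding M_def Ka_def Kc_def using R by (intro mult_nonneg_nonneg prod_nonneg) auto
  ultimately show ?thesis by blast
qed

lemma norm_rho: "norm rho < 1"
  using conv by (simp only: rho_def)

lemma kernel_term_bound:
  assumes R: "R \<ge> 1" and e: "e < n"
  shows "\<exists>M. \<forall>z y. 1 / R \<le> norm z \<and> norm z \<le> R \<longrightarrow> norm (kernel_term e z y) \<le> M * norm rho ^ nat \<bar>y\<bar>"
proof -
  obtain M where M: "\<And>z k. 1 / R \<le> norm z \<Longrightarrow> norm z \<le> R \<Longrightarrow> norm (kernel_term e z (int k)) \<le> M * norm rho ^ k"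
    using kernel_term_of_nat_bound[OF assms] by blast
  have "norm (kernel_term e z y) \<le> M * norm rho ^ nat \<bar>y\<bar>" if z: "1 / R \<le> norm z" "norm z \<le> R" for z y
  proof (cases "0 \<le> y")
    case True
    thus ?thesis using M[OF z, of "nat y"] by simp
  next
    case False
    have pos: "0 < norm z" using z R by (smt (verit) divide_pos_pos)
    have "1 / R \<le> norm (1 / z)" "norm (1 / z) \<le> R"
      using z pos R by (simp_all add: norm_divide divide_simps mult.commute)
    from M[OF this, of "nat (- y)"] show ?thesis
      using False kernel_term_inverse[of e z y] by simp
  qed
  thus ?thesis by blast
qed

lemma norm_kernel_term_summable:
  assumes "z \<noteq> 0" "e < n"
  shows "(\<lambda>y. norm (kernel_term e z y)) summable_on UNIV"
proof -
  define R where "R = max 1 (max (norm z) (1 / norm z))"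
  have "R \<ge> 1" "norm z \<le> R" "1 / norm z \<le> R" by (auto simp: R_def)
  moreover from this have "1 / R \<le> norm z" using assms by (simp add: field_simps)
  ultimately obtain M where M: "\<And>y. norm (kernel_term e z y) \<le> M * norm rho ^ nat \<bar>y\<bar>"
    using kernel_term_bound[of R e] assms by blast
  have "(\<lambda>y::int. M * norm rho ^ nat \<bar>y\<bar>) summable_on UNIV"
    by (intro summable_on_cmult_right summable_on_int_norm_power norm_rho) auto
  thus ?thesis by (rule summable_on_comparison_test) (use M in auto)
qed

section \<open>Holomorphy and symmetry of the averages\<close>

lemma holomorphic_H: "f holomorphic_on S \<Longrightarrow> (\<And>x. x \<in> S \<Longrightarrow> f x \<noteq> 0) \<Longrightarrow> (\<lambda>x. H (f x)) holomorphic_on S"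
  unfolding H_def qpoch_of_nat by (intro holomorphic_intros) (use a_nz in auto)

lemma holomorphic_kernel_term: "(\<lambda>z. kernel_term e z y) holomorphic_on -{0}"
  unfolding kernel_term_def weight_def psi_def by (intro holomorphic_intros holomorphic_H) auto

definition Psi :: "nat \<Rightarrow> complex \<Rightarrow> complex" where
  "Psi e z = (\<Sum>\<^sub>\<infinity>y. kernel_term e z y)"

lemma holomorphic_Psi:
  assumes e: "e < n"
  shows "Psi e holomorphic_on -{0}"
proof -
  have "\<exists>r>0. Psi e holomorphic_on ball w r" if w: "w \<noteq> 0" for w
  proof -
    define r where "r = norm w / 2"
    have r: "r > 0" using w by (simp add: r_def)
    \<comment> \<open>With \<open>r\<close> half of \<open>norm w\<close>, norms on the disc lie
      between \<open>r\<close> and \<open>norm w + r\<close>, hence in the annulus given by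
      \<open>R\<close>.\<close>
    define R where "R = max 1 (max (norm w + r) (1 / r))"
    have R: "R \<ge> 1" "norm w + r \<le> R" "1 / r \<le> R" by (auto simp: R_def)
    have norms: "1 / R \<le> norm z \<and> norm z \<le> R" if z: "z \<in> cball w r" for z
    proof -
      have "norm (z - w) \<le> r" using z by (simp add: dist_norm norm_minus_commute)
      hence "norm z \<le> norm w + r" "norm w - r \<le> norm z"
        using norm_triangle_ineq2[of z w] norm_triangle_ineq3[of w z] by (auto simp: norm_minus_commute)
      moreover have "norm w - r = r" by (simp add: r_def)
      moreover have "1 / R \<le> r" using R r by (simp add: field_simps)
      ultimately show ?thesis using R by linarith
    qed
    obtain M where M: "\<And>z y. 1 / R \<le> norm z \<Longrightarrow> norm z \<le> R \<Longrightarrow> norm (kernel_term e z y) \<le> M * norm rho ^ nat \<bar>y\<bar>"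
      using kernel_term_bound[OF R(1) e] by blast
    have "uniform_limit (cball w r) (\<lambda>X z. \<Sum>y\<in>X. kernel_term e z y) (\<lambda>z. \<Sum>\<^sub>\<infinity>y. kernel_term e z y) (finite_subsets_at_top UNIV)"
    proof (rule Weierstrass_m_test_general)
      show "(\<lambda>y::int. M * norm rho ^ nat \<bar>y\<bar>) summable_on UNIV"
        by (intro summable_on_cmult_right summable_on_int_norm_power norm_rho) auto
      show "norm (kernel_term e z y) \<le> M * norm rho ^ nat \<bar>y\<bar>" if "z \<in> cball w r" for z y
        using M norms[OF that] by blast
    qed
    hence lim: "uniform_limit (cball w r) (\<lambda>X z. \<Sum>y\<in>X. kernel_term e z y) (Psi e) (finite_subsets_at_top UNIV)"
      by (simp add: Psi_def[abs_def])
    have sub: "cball w r \<subseteq> -{0}"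
      using r by (auto simp: r_def)
    have hol: "(\<lambda>z. \<Sum>y\<in>X. kernel_term e z y) holomorphic_on cball w r" for X
      by (intro holomorphic_on_sum holomorphic_on_subset[OF holomorphic_kernel_term sub])
    have "\<forall>\<^sub>F X in finite_subsets_at_top UNIV. continuous_on (cball w r) (\<lambda>z. \<Sum>y\<in>X. kernel_term e z y) \<and>
        (\<lambda>z. \<Sum>y\<in>X. kernel_term e z y) holomorphic_on ball w r"
      by (intro always_eventually allI conjI holomorphic_on_imp_continuous_on hol
            holomorphic_on_subset[OF hol ball_subset_cball])
    from holomorphic_uniform_limit[OF this lim] have "Psi e holomorphic_on ball w r"
      by simp
    thus ?thesis using r by blast
  qed
  hence "Psi e analytic_on -{0}"
    unfolding analytic_on_def by blast
  thus ?thesis by (rule analytic_imp_holomorphic)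
qed

text \<open>Both symmetries are substitutions in the summation index: \<open>z\<close> to
  \<open>q * z\<close> corresponds to \<open>y\<close> to \<open>y + 1\<close>, inversion to
  \<open>y\<close> to \<open>- y\<close>.\<close>

lemma qsym_Psi:
  assumes e: "e < n"
  shows "qsym (q powi (- int (n + 1))) (2 * int n + 2) (- 1) (Psi e)"
proof -
  have "Psi e (q * z) = q powi (- int (n + 1)) * z powi (- (2 * int n + 2)) * Psi e z" if "z \<noteq> 0" for z
  proof -
    have "Psi e (q * z) = q powi (- int (n + 1)) * z powi (- (2 * int n + 2)) * (\<Sum>\<^sub>\<infinity>y. kernel_term e z (y + 1))"
      unfolding Psi_def kernel_term_q[OF that] by (rule infsum_cmult_right')
    also have "(\<Sum>\<^sub>\<infinity>y. kernel_term e z (y + 1)) = Psi e z"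
      unfolding Psi_def
      by (rule infsum_reindex_bij_betw) (rule bij_betw_byWitness[where f' = "\<lambda>y. y - 1"], auto)
    finally show ?thesis .
  qed
  moreover have "Psi e (1 / z) = - 1 * Psi e z" for z
  proof -
    have "Psi e (1 / z) = (\<Sum>\<^sub>\<infinity>y. kernel_term e (1 / z) (- y))"
      unfolding Psi_def
      by (rule infsum_reindex_bij_betw[symmetric]) (rule bij_betw_byWitness[where f' = uminus], auto)
    also have "\<dots> = - Psi e z"
      unfolding Psi_def kernel_term_inverse by (rule infsum_uminus)
    finally show ?thesis by simp
  qed
  ultimately show ?thesis
    using holomorphic_Psi[OF e] unfolding qsym_def quasi_def by blast
qed

end

subsection \<open>The multiple series\<close>

lemma prod_square_pairs:
  fixes f :: "nat \<Rightarrow> nat \<Rightarrow> 'a::comm_monoid_mult"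
  shows "(\<Prod>j=1..n. \<Prod>k=1..n. f j k) = (\<Prod>j=1..n. f j j) * (\<Prod>(j, k)\<in>pairs n. f j k * f k j)"
proof -
  have "(\<Prod>j=1..n. \<Prod>k=1..n. f j k) = (\<Prod>(j, k)\<in>{1..n} \<times> {1..n}. f j k)"
    by (rule prod.cartesian_product)
  also have "{1..n} \<times> {1..n} = (\<lambda>j. (j, j)) ` {1..n} \<union> (pairs n \<union> prod.swap ` pairs n)"
  proof (rule set_eqI, rule prod.induct)
    fix j k
    have "(j, k) \<in> prod.swap ` pairs n \<longleftrightarrow> (k, j) \<in> pairs n" by force
    thus "(j, k) \<in> {1..n} \<times> {1..n} \<longleftrightarrow>
        (j, k) \<in> (\<lambda>j. (j, j)) ` {1..n} \<union> (pairs n \<union> prod.swap ` pairs n)"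
      by (auto simp: mem_pairs)
  qed
  also have "(\<Prod>(j, k)\<in>\<dots>. f j k) = (\<Prod>(j, k)\<in>(\<lambda>j. (j, j)) ` {1..n}. f j k) *
      ((\<Prod>(j, k)\<in>pairs n. f j k) * (\<Prod>(j, k)\<in>prod.swap ` pairs n. f j k))"
    by (subst prod.union_disjoint, (auto simp: mem_pairs)[3])+ simp
  also have "(\<Prod>(j, k)\<in>(\<lambda>j. (j, j)) ` {1..n}. f j k) = (\<Prod>j=1..n. f j j)"
    by (subst prod.reindex) (auto simp: inj_on_def)
  also have "(\<Prod>(j, k)\<in>prod.swap ` pairs n. f j k) = (\<Prod>(j, k)\<in>pairs n. f k j)"
    by (subst prod.reindex) (auto simp: case_prod_unfold)
  also have "(\<Prod>(j, k)\<in>pairs n. f j k) * (\<Prod>(j, k)\<in>pairs n. f k j) = (\<Prod>(j, k)\<in>pairs n. f j k * f k j)"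
    by (simp add: prod.distrib[symmetric] case_prod_unfold)
  finally show ?thesis .
qed

lemma prod_triangle_pairs:
  fixes f :: "nat \<Rightarrow> nat \<Rightarrow> 'a::comm_monoid_mult"
  shows "(\<Prod>j=1..n. \<Prod>k=j..n. f j k) = (\<Prod>j=1..n. f j j) * (\<Prod>(j, k)\<in>pairs n. f j k)"
proof -
  have "(\<Prod>k=j..n. f j k) = f j j * (\<Prod>k\<in>{j<..n}. f j k)" if "j \<in> {1..n}" for j
    using that by (subst prod.head) auto
  hence "(\<Prod>j=1..n. \<Prod>k=j..n. f j k) = (\<Prod>j=1..n. f j j * (\<Prod>k\<in>{j<..n}. f j k))"
    by (intro prod.cong) auto
  thus ?thesis by (simp only: prod.distrib prod_pairs)
qed

lemma prod_pairs_mult: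
  fixes u :: "nat \<Rightarrow> 'a::comm_monoid_mult"
  shows "(\<Prod>(j, k)\<in>pairs n. u j * u k) = (\<Prod>j=1..n. u j ^ (n - 1))"
proof -
  have "(\<Prod>(j, k)\<in>pairs n. u j * u k) =
      (\<Prod>p\<in>pairs n. \<Prod>i=1..n. if fst p = i \<or> snd p = i then u i else 1)"
  proof (rule prod.cong[OF refl])
    fix p assume "p \<in> pairs n"
    then obtain j k where p: "p = (j, k)" "j \<in> {1..n}" "k \<in> {1..n}" "j \<noteq> k"
      by (cases p) (auto simp: mem_pairs)
    have "(\<Prod>i=1..n. if fst p = i \<or> snd p = i then u i else 1)
        = (\<Prod>i=1..n. (if i = j then u i else 1) * (if i = k then u i else 1))"
      by (rule prod.cong) (use p in auto)
    also have "\<dots> = u j * u k"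
      using p by (simp add: prod.distrib prod.delta)
    finally show "(case p of (j, k) \<Rightarrow> u j * u k) =
        (\<Prod>i=1..n. if fst p = i \<or> snd p = i then u i else 1)"
      by (simp add: p(1))
  qed
  also have "\<dots> = (\<Prod>i=1..n. \<Prod>p\<in>pairs n. if fst p = i \<or> snd p = i then u i else 1)"
    by (rule prod.swap)
  also have "\<dots> = (\<Prod>i=1..n. u i ^ (n - 1))"
  proof (rule prod.cong[OF refl])
    fix i assume "i \<in> {1..n}"
    have "(\<Prod>p\<in>pairs n. if fst p = i \<or> snd p = i then u i else 1) =
        u i ^ card {p \<in> pairs n. fst p = i \<or> snd p = i}"
      by (simp add: prod.If_cases Int_def)
    thus "(\<Prod>p\<in>pairs n. if fst p = i \<or> snd p = i then u i else 1) = u i ^ (n - 1)"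
      by (simp only: card_pairs_incident[OF \<open>i \<in> {1..n}\<close>])
  qed
  finally show ?thesis .
qed

section \<open>The Weyl denominator as a Vandermonde product\<close>

definition joukowski :: "complex \<Rightarrow> complex" where
  "joukowski u = u + 1 / u"

text \<open>The Weyl denominator, divided by the \<open>n\<close>-th powers of the variables.\<close>

definition Wsym :: "nat \<Rightarrow> (nat \<Rightarrow> complex) \<Rightarrow> complex" where
  "Wsym n u = (\<Prod>j=1..n. 1 / u j - u j) * (\<Prod>(j, k)\<in>pairs n. joukowski (u k) - joukowski (u j))"

lemma Wsym_cong: "(\<And>k. k \<in> {1..n} \<Longrightarrow> u k = v k) \<Longrightarrow> Wsym n u = Wsym n v"
  unfolding Wsym_def by (intro arg_cong2[where f = "(*)"] prod.cong) (auto simp: mem_pairs)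

text \<open>Rests on \<open>(1 - s * t) * (s - t) = s * t * (joukowski t - joukowski s)\<close> and
  \<open>1 - s * s = s * (1 / s - s)\<close>. Each variable is split off once for every pair
  containing it and once more on the diagonal, \<open>n\<close> times in all.\<close>

lemma W_eq_Wsym:
  assumes u: "\<And>k. k \<in> {1..n} \<Longrightarrow> u k \<noteq> 0"
  shows "W n u = (\<Prod>j=1..n. u j ^ n) * Wsym n u"
proof (cases "n = 0")
  case True
  thus ?thesis by (simp add: W_def Wsym_def pairs_def)
next
  case False
  have "W n u = (\<Prod>j=1..n. 1 - u j * u j) *
      ((\<Prod>(j, k)\<in>pairs n. 1 - u j * u k) * (\<Prod>(j, k)\<in>pairs n. u j - u k))"
    unfolding W_def prod_triangle_pairs prod_pairs by (simp only: mult_ac)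
  also have "(\<Prod>(j, k)\<in>pairs n. 1 - u j * u k) * (\<Prod>(j, k)\<in>pairs n. u j - u k)
      = (\<Prod>(j, k)\<in>pairs n. (1 - u j * u k) * (u j - u k))"
    by (simp add: prod.distrib[symmetric] case_prod_unfold)
  also have "\<dots> = (\<Prod>(j, k)\<in>pairs n. u j * u k * (joukowski (u k) - joukowski (u j)))"
  proof (rule prod.cong[OF refl], clarify)
    fix j k assume "(j, k) \<in> pairs n"
    hence "u j \<noteq> 0" "u k \<noteq> 0" using u by (auto simp: mem_pairs)
    thus "(1 - u j * u k) * (u j - u k) = u j * u k * (joukowski (u k) - joukowski (u j))"
      by (simp add: joukowski_def field_simps)
  qed
  also have "\<dots> = (\<Prod>j=1..n. u j ^ (n - 1)) * (\<Prod>(j, k)\<in>pairs n. joukowski (u k) - joukowski (u j))"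
    unfolding prod_pairs_mult[symmetric] by (simp add: prod.distrib[symmetric] case_prod_unfold)
  also have "(\<Prod>j=1..n. 1 - u j * u j) = (\<Prod>j=1..n. u j * (1 / u j - u j))"
    by (intro prod.cong) (use u in \<open>auto simp: right_diff_distrib\<close>)
  also have "(\<Prod>j=1..n. u j * (1 / u j - u j)) *
      ((\<Prod>j=1..n. u j ^ (n - 1)) * (\<Prod>(j, k)\<in>pairs n. joukowski (u k) - joukowski (u j)))
     = (\<Prod>j=1..n. u j * u j ^ (n - 1)) * Wsym n u"
    unfolding Wsym_def prod.distrib by (simp only: mult_ac)
  also have "(\<Prod>j=1..n. u j * u j ^ (n - 1)) = (\<Prod>j=1..n. u j ^ n)"
    using False by (simp add: power_eq_if)
  finally show ?thesis .
qed

lemma Wsym_anti: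
  assumes ij: "i \<in> {1..n}" "j \<in> {1..n}" "i \<noteq> j"
  shows "Wsym n (u \<circ> Transposition.transpose i j) = - Wsym n u"
proof -
  have "(\<Prod>k=1..n. 1 / (u \<circ> Transposition.transpose i j) k - (u \<circ> Transposition.transpose i j) k)
      = (\<Prod>k=1..n. 1 / u k - u k)"
    unfolding o_def by (rule prod.reindex_bij_betw[OF bij_betw_transpose[OF ij(1,2)]])
  moreover have "(\<Prod>(a, b)\<in>pairs n. joukowski (u (Transposition.transpose i j b)) -
        joukowski (u (Transposition.transpose i j a)))
      = - (\<Prod>(a, b)\<in>pairs n. joukowski (u b) - joukowski (u a))"
    by (rule prod_pairs_transpose[OF ij]) simp
  ultimately show ?thesis by (simp add: Wsym_def)
qed

text \<open>Expanding the Vandermonde product means picking one element of every pair.\<close>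

definition pick :: "(nat \<times> nat) set \<Rightarrow> nat \<times> nat \<Rightarrow> nat" where
  "pick B p = (if p \<in> B then snd p else fst p)"

text \<open>The exponent of \<open>joukowski (v j)\<close> in the monomial chosen by
  \<open>B\<close>.\<close>

definition pick_count :: "nat \<Rightarrow> (nat \<times> nat) set \<Rightarrow> nat \<Rightarrow> nat" where
  "pick_count n B j = card {p \<in> pairs n. pick B p = j}"

text \<open>This strict bound is the condition \<open>e < n\<close> under which the one-variable
  averages converge.\<close>

lemma pick_count_less:
  assumes "j \<in> {1..n}"
  shows "pick_count n B j < n"
proof -
  have "pick_count n B j \<le> card {p \<in> pairs n. fst p = j \<or> snd p = j}"
    unfolding pick_count_def by (rule card_mono) (auto simp: pick_def split: if_splits)
  also have "\<dots> = n - 1" by (rule card_pairs_incident[OF assms])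
  finally show ?thesis using assms by auto
qed

text \<open>A subset \<open>B\<close> records in which pairs the second variable is picked, and
  every other pair contributes a sign. Monomials may repeat or cancel; later steps rely only on
  their exponents being below \<open>n\<close>.\<close>

lemma Wsym_expand:
  "Wsym n v = (\<Sum>B\<in>Pow (pairs n). (- 1) ^ card (pairs n - B) *
      (\<Prod>j=1..n. (1 / v j - v j) * joukowski (v j) ^ pick_count n B j))"
proof -
  have "(\<Prod>(j, k)\<in>pairs n. joukowski (v k) - joukowski (v j))
      = (\<Prod>p\<in>pairs n. joukowski (v (snd p)) + (- joukowski (v (fst p))))"
    by (simp add: case_prod_unfold)
  also have "\<dots> = (\<Sum>B\<in>Pow (pairs n). (\<Prod>p\<in>B. joukowski (v (snd p))) *
      (\<Prod>p\<in>pairs n - B. - joukowski (v (fst p))))"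
    by (rule prod_add) simp
  also have "\<dots> = (\<Sum>B\<in>Pow (pairs n). (- 1) ^ card (pairs n - B) *
      (\<Prod>j=1..n. joukowski (v j) ^ pick_count n B j))"
  proof (rule sum.cong[OF refl])
    fix B assume "B \<in> Pow (pairs n)"
    hence B: "B \<subseteq> pairs n" by simp
    have "(\<Prod>p\<in>pairs n - B. - joukowski (v (fst p)))
        = (- 1) ^ card (pairs n - B) * (\<Prod>p\<in>pairs n - B. joukowski (v (pick B p)))"
      by (subst prod_uminus) (auto simp: pick_def intro!: prod.cong)
    moreover have "(\<Prod>p\<in>B. joukowski (v (snd p))) = (\<Prod>p\<in>B. joukowski (v (pick B p)))"
      by (intro prod.cong) (auto simp: pick_def)
    moreover have "(\<Prod>p\<in>pairs n. joukowski (v (pick B p)))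
        = (\<Prod>p\<in>pairs n - B. joukowski (v (pick B p))) * (\<Prod>p\<in>B. joukowski (v (pick B p)))"
      by (rule prod.subset_diff[OF B]) simp
    moreover have "(\<Prod>p\<in>pairs n. joukowski (v (pick B p))) = (\<Prod>j=1..n. joukowski (v j) ^ pick_count n B j)"
    proof -
      have "(\<Prod>p\<in>pairs n. joukowski (v (pick B p))) =
          (\<Prod>j=1..n. \<Prod>p\<in>{p \<in> pairs n. pick B p = j}. joukowski (v (pick B p)))"
        by (rule prod.group[symmetric]) (auto simp: pick_def mem_pairs)
      also have "\<dots> = (\<Prod>j=1..n. joukowski (v j) ^ pick_count n B j)"
        by (intro prod.cong) (auto simp: pick_count_def)
      finally show ?thesis .
    qed
    ultimately show "(\<Prod>p\<in>B. joukowski (v (snd p))) * (\<Prod>p\<in>pairs n - B. - joukowski (v (fst p)))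
        = (- 1) ^ card (pairs n - B) * (\<Prod>j=1..n. joukowski (v j) ^ pick_count n B j)"
      by (simp only: mult_ac)
  qed
  finally show ?thesis
    by (simp add: Wsym_def sum_distrib_left prod.distrib mult_ac)
qed

lemma power_int_sum:
  fixes x :: "'a::field"
  assumes "x \<noteq> 0"
  shows "x powi (\<Sum>k\<in>A. f k) = (\<Prod>k\<in>A. x powi f k)"
  using assms by (induction A rule: infinite_finite_induct) (auto simp: power_int_add)

lemma has_sum_sum:
  fixes f :: "'i \<Rightarrow> 'a \<Rightarrow> 'b::topological_comm_monoid_add"
  assumes "\<And>i. i \<in> I \<Longrightarrow> (f i has_sum s i) A"
  shows "((\<lambda>x. \<Sum>i\<in>I. f i x) has_sum (\<Sum>i\<in>I. s i)) A"
  using assms by (induction I rule: infinite_finite_induct) (auto intro: has_sum_add)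

lemma abs_summable_on_int_lattice_prod:
  fixes f :: "nat \<Rightarrow> int \<Rightarrow> complex"
  assumes "\<And>k. k \<in> {1..n} \<Longrightarrow> (\<lambda>y. norm (f k y)) summable_on UNIV"
  shows "(\<lambda>y. norm (\<Prod>k=1..n. f k (y k))) summable_on int_lattice n"
  using abs_summable_on_prod_PiE[of "{1..n}" "\<lambda>_. UNIV" f] assms
  unfolding int_lattice_def by (simp add: abs_summable_equivalent)

section \<open>Comparison of the theta and Weyl denominators\<close>

context nome
begin

text \<open>Splitting \<open>1 - x\<close> off every theta function leaves \<open>Wsym\<close> up to
  sign, times the infinite products of the prefactor. The diagonal \<open>j = k\<close> of the
  square product is absent from \<open>Delta\<close>; it accounts for the power of
  \<open>qpoch_inf q q\<close>.\<close>

lemma Delta_eq_Wsym: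
  assumes u: "\<And>k. k \<in> {1..n} \<Longrightarrow> u k \<noteq> 0"
  shows "Delta n u * qpoch_inf q q ^ n = (- 1) ^ card (pairs n) * Wsym n u *
    (\<Prod>j=1..n. \<Prod>k=j..n. qpoch_inf q (q * u j * u k) * qpoch_inf q (q / (u j * u k))) *
    (\<Prod>j=1..n. \<Prod>k=1..n. qpoch_inf q (q * u k / u j))"
proof -
  define K where "K j k = qpoch_inf q (q * u j * u k) * qpoch_inf q (q / (u j * u k))" for j k
  define L where "L j k = qpoch_inf q (q * u k / u j)" for j k
  have 1: "(\<Prod>j=1..n. theta (u j * u j) / u j) = (\<Prod>j=1..n. 1 / u j - u j) * (\<Prod>j=1..n. K j j)"
    unfolding prod.distrib[symmetric]
  proof (rule prod.cong[OF refl])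
    fix j assume "j \<in> {1..n}"
    hence "u j \<noteq> 0" by (rule u)
    thus "theta (u j * u j) / u j = (1 / u j - u j) * K j j"
      by (simp add: theta_eq K_def mult.assoc diff_divide_distrib left_diff_distrib)
  qed
  have 2: "(\<Prod>(j, k)\<in>pairs n. theta_pair (u j) (u k)) = (\<Prod>(j, k)\<in>pairs n. - 1) *
      (\<Prod>(j, k)\<in>pairs n. joukowski (u k) - joukowski (u j)) * (\<Prod>(j, k)\<in>pairs n. K j k) *
      (\<Prod>(j, k)\<in>pairs n. L j k * L k j)"
    unfolding prod.distrib[symmetric] case_prod_unfold
  proof (rule prod.cong[OF refl])
    fix p assume "p \<in> pairs n"
    then obtain j k where p: "p = (j, k)" "u j \<noteq> 0" "u k \<noteq> 0"
      using u by (cases p) (auto simp: mem_pairs)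
    have T: "theta (u j * u k) = (1 - u j * u k) * K j k"
      by (simp add: theta_eq K_def mult.assoc)
    have T': "theta (u j / u k) = (1 - u j / u k) * (L k j * L j k)"
      by (simp add: theta_eq L_def)
    have J: "(1 - u j * u k) * (1 - u j / u k) / u j = - (joukowski (u k) - joukowski (u j))"
      using p by (simp add: joukowski_def field_simps)
    have "theta_pair (u j) (u k) = ((1 - u j * u k) * (1 - u j / u k) / u j) * K j k * (L j k * L k j)"
      by (simp add: theta_pair_def T T')
    also have "\<dots> = - 1 * (joukowski (u k) - joukowski (u j)) * K j k * (L j k * L k j)"
      unfolding J by simp
    finally show "theta_pair (u (fst p)) (u (snd p)) = - 1 * (joukowski (u (snd p)) - joukowski (u (fst p))) *
        K (fst p) (snd p) * (L (fst p) (snd p) * L (snd p) (fst p))"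
      by (simp add: p(1))
  qed
  have 3: "(\<Prod>j=1..n. L j j) = qpoch_inf q q ^ n"
    using u by (simp add: L_def)
  have "Delta n u * qpoch_inf q q ^ n = (\<Prod>(j, k)\<in>pairs n. - 1) * Wsym n u *
     ((\<Prod>j=1..n. K j j) * (\<Prod>(j, k)\<in>pairs n. K j k)) *
     ((\<Prod>j=1..n. L j j) * (\<Prod>(j, k)\<in>pairs n. L j k * L k j))"
    unfolding Delta_def Wsym_def 1 2 3 by (simp only: mult_ac)
  thus ?thesis
    unfolding prod_triangle_pairs prod_square_pairs K_def[symmetric] L_def[symmetric]
    by (simp add: case_prod_unfold)
qed

end

section \<open>The multiple average and its uniqueness\<close>

context kernel
begin

text \<open>The summand cleared of denominators. It makes sense at all nonzero arguments, as
  required by the uniqueness argument, which moves the variables through arbitrary points.\<close>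

definition lattice_term :: "(nat \<Rightarrow> complex) \<Rightarrow> (nat \<Rightarrow> int) \<Rightarrow> complex" where
  "lattice_term u y = (\<Prod>k=1..n. weight (u k) (y k) * H (u k * q powi y k)) *
     Wsym n (\<lambda>k. u k * q powi y k)"

definition Omega :: "(nat \<Rightarrow> complex) \<Rightarrow> complex" where
  "Omega u = (\<Sum>\<^sub>\<infinity>y\<in>int_lattice n. lattice_term u y)"

lemma lattice_term_expand:
  "lattice_term u y = (\<Sum>B\<in>Pow (pairs n). (- 1) ^ card (pairs n - B) *
      (\<Prod>j=1..n. kernel_term (pick_count n B j) (u j) (y j)))"
  unfolding lattice_term_def Wsym_expand sum_distrib_left kernel_term_def psi_def joukowski_def[symmetric]
  by (intro sum.cong refl) (simp add: prod.distrib mult_ac)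

lemma norm_lattice_term_summable:
  assumes u: "\<And>k. k \<in> {1..n} \<Longrightarrow> u k \<noteq> 0"
  shows "(\<lambda>y. norm (lattice_term u y)) summable_on int_lattice n"
proof -
  have prod: "(\<lambda>y. norm (\<Prod>j=1..n. kernel_term (pick_count n B j) (u j) (y j))) summable_on int_lattice n" for B
    by (rule abs_summable_on_int_lattice_prod[of n "\<lambda>j. kernel_term (pick_count n B j) (u j)"])
       (intro norm_kernel_term_summable u pick_count_less)
  have "(\<lambda>y. \<Sum>B\<in>Pow (pairs n). norm (\<Prod>j=1..n. kernel_term (pick_count n B j) (u j) (y j))) summable_on int_lattice n"
    by (rule has_sum_imp_summable, rule has_sum_sum, rule has_sum_infsum, rule prod)
  thus ?thesis
  proof (rule summable_on_comparison_test)
    fix y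
    have "norm (lattice_term u y) \<le> (\<Sum>B\<in>Pow (pairs n). norm ((- 1) ^ card (pairs n - B) *
        (\<Prod>j=1..n. kernel_term (pick_count n B j) (u j) (y j))))"
      unfolding lattice_term_expand by (rule norm_sum)
    thus "norm (lattice_term u y) \<le> (\<Sum>B\<in>Pow (pairs n). norm (\<Prod>j=1..n. kernel_term (pick_count n B j) (u j) (y j)))"
      by (simp add: norm_mult norm_power)
  qed auto
qed

text \<open>The one-variable sums converge absolutely, so for each \<open>B\<close> the sum over the
  lattice factors into a product of them.\<close>

lemma Omega_eq:
  assumes u: "\<And>k. k \<in> {1..n} \<Longrightarrow> u k \<noteq> 0"
  shows "Omega u = (\<Sum>B\<in>Pow (pairs n). (- 1) ^ card (pairs n - B) *
      (\<Prod>j=1..n. Psi (pick_count n B j) (u j)))"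
proof -
  have prod: "(\<lambda>y. \<Prod>j=1..n. kernel_term (pick_count n B j) (u j) (y j)) summable_on int_lattice n" for B
    by (rule abs_summable_summable,
        rule abs_summable_on_int_lattice_prod[of n "\<lambda>j. kernel_term (pick_count n B j) (u j)"])
       (intro norm_kernel_term_summable u pick_count_less)
  have "Omega u = (\<Sum>B\<in>Pow (pairs n). \<Sum>\<^sub>\<infinity>y\<in>int_lattice n. (- 1) ^ card (pairs n - B) *
      (\<Prod>j=1..n. kernel_term (pick_count n B j) (u j) (y j)))"
    unfolding Omega_def lattice_term_expand
    by (rule infsumI, rule has_sum_sum, rule has_sum_infsum, intro summable_on_cmult_right prod)
  also have "\<dots> = (\<Sum>B\<in>Pow (pairs n). (- 1) ^ card (pairs n - B) *
      (\<Sum>\<^sub>\<infinity>y\<in>int_lattice n. \<Prod>j=1..n. kernel_term (pick_count n B j) (u j) (y j)))"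
    by (intro sum.cong refl infsum_cmult_right')
  also have "\<dots> = (\<Sum>B\<in>Pow (pairs n). (- 1) ^ card (pairs n - B) *
      (\<Prod>j=1..n. Psi (pick_count n B j) (u j)))"
    unfolding int_lattice_def Psi_def
    by (intro sum.cong refl arg_cong2[where f = "(*)"] infsum_prod_PiE_abs)
       (auto intro!: norm_kernel_term_summable u pick_count_less)
  finally show ?thesis .
qed

lemma Omega_cong:
  assumes "\<And>k. k \<in> {1..n} \<Longrightarrow> u k = v k"
  shows "Omega u = Omega v"
proof -
  have "lattice_term u y = lattice_term v y" for y
    unfolding lattice_term_def using assms
    by (intro arg_cong2[where f = "(*)"] prod.cong Wsym_cong) auto
  thus ?thesis by (simp add: Omega_def)
qed

text \<open>Permuting the summation index in the same way turns a permutation of \<open>u\<close>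
  into one of all points \<open>u k * q powi y k\<close>, under which only \<open>Wsym\<close>
  changes sign.\<close>

lemma Omega_anti:
  assumes ij: "i \<in> {1..n}" "j \<in> {1..n}" "i \<noteq> j"
  shows "Omega (u \<circ> Transposition.transpose i j) = - Omega u"
proof -
  define s where "s = Transposition.transpose i j"
  have bij: "bij_betw (\<lambda>y. y \<circ> s) (int_lattice n) (int_lattice n)"
  proof (rule bij_betw_byWitness[where f' = "\<lambda>y. y \<circ> s"])
    have "y \<circ> s \<in> int_lattice n" if "y \<in> int_lattice n" for y
      using that ij by (auto simp: int_lattice_def PiE_def extensional_def s_def Transposition.transpose_def)
    thus "(\<lambda>y. y \<circ> s) ` int_lattice n \<subseteq> int_lattice n" "(\<lambda>y. y \<circ> s) ` int_lattice n \<subseteq> int_lattice n"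
      by auto
  qed (auto simp: s_def fun_eq_iff)
  have "Omega (u \<circ> s) = (\<Sum>\<^sub>\<infinity>y\<in>int_lattice n. lattice_term (u \<circ> s) (y \<circ> s))"
    unfolding Omega_def by (rule infsum_reindex_bij_betw[OF bij, symmetric])
  also have "(\<lambda>y. lattice_term (u \<circ> s) (y \<circ> s)) = (\<lambda>y. - lattice_term u y)"
  proof
    fix y
    have "(\<Prod>k=1..n. weight ((u \<circ> s) k) ((y \<circ> s) k) * H ((u \<circ> s) k * q powi (y \<circ> s) k))
        = (\<Prod>k=1..n. weight (u k) (y k) * H (u k * q powi y k))"
      unfolding o_def s_def by (rule prod.reindex_bij_betw[OF bij_betw_transpose[OF ij(1,2)]])
    moreover have "Wsym n (\<lambda>k. (u \<circ> s) k * q powi (y \<circ> s) k) = - Wsym n (\<lambda>k. u k * q powi y k)"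
      using Wsym_anti[OF ij, of "\<lambda>k. u k * q powi y k"] by (simp add: s_def o_def)
    ultimately show "lattice_term (u \<circ> s) (y \<circ> s) = - lattice_term u y"
      by (simp add: lattice_term_def)
  qed
  also have "(\<Sum>\<^sub>\<infinity>y\<in>int_lattice n. - lattice_term u y) = - Omega u"
    unfolding Omega_def by (rule infsum_uminus)
  finally show ?thesis by (simp only: s_def)
qed

lemma qsym_Omega:
  assumes i: "i \<in> {1..n}" and u: "\<And>k. k \<in> {1..n} \<Longrightarrow> u k \<noteq> 0"
  shows "qsym (q powi (- int (n + 1))) (2 * int n + 2) (- 1) (\<lambda>s. Omega (u(i := s)))"
proof (rule qsym_transform)
  show "qsym (q powi (- int (n + 1))) (2 * int n + 2) (- 1)
     (\<lambda>s. \<Sum>B\<in>Pow (pairs n). (- 1) ^ card (pairs n - B) *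
        ((\<Prod>j\<in>{1..n} - {i}. Psi (pick_count n B j) (u j)) * Psi (pick_count n B i) s))"
    by (intro qsym_sum qsym_cmult qsym_Psi pick_count_less i)
  fix s :: complex assume s: "s \<noteq> 0"
  have "(\<Prod>j=1..n. Psi (pick_count n B j) ((u(i := s)) j)) =
      (\<Prod>j\<in>{1..n} - {i}. Psi (pick_count n B j) (u j)) * Psi (pick_count n B i) s" for B
    by (subst prod.remove[OF _ i]) (auto simp: mult.commute)
  moreover have "Omega (u(i := s)) = (\<Sum>B\<in>Pow (pairs n). (- 1) ^ card (pairs n - B) *
      (\<Prod>j=1..n. Psi (pick_count n B j) ((u(i := s)) j)))"
    by (rule Omega_eq) (use u s in auto)
  ultimately show "(\<Sum>B\<in>Pow (pairs n). (- 1) ^ card (pairs n - B) *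
        ((\<Prod>j\<in>{1..n} - {i}. Psi (pick_count n B j) (u j)) * Psi (pick_count n B i) s)) = Omega (u(i := s))"
    by simp
qed

text \<open>The combination \<open>Delta n w * Omega u - Omega w * Delta n u\<close> inherits all
  symmetries by linearity and vanishes at \<open>u = w\<close> by construction.\<close>

lemma Omega_Delta:
  assumes w: "generic n w" and z: "\<And>k. k \<in> {1..n} \<Longrightarrow> z k \<noteq> 0"
  shows "Omega z * Delta n w = Omega w * Delta n z"
proof -
  have "Delta n w * Omega z - Omega w * Delta n z = 0"
  proof (rule alternating_eq_0[where F = "\<lambda>u. Delta n w * Omega u - Omega w * Delta n u", OF w _ _ _ _ z])
    show "Delta n w * Omega u - Omega w * Delta n u = Delta n w * Omega v - Omega w * Delta n v"
      if "\<And>k. k \<in> {1..n} \<Longrightarrow> u k = v k" for u v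
      using Omega_cong[OF that] Delta_cong[OF that] by simp
    show "qsym (q powi (- int (n + 1))) (2 * int n + 2) (- 1)
        (\<lambda>s. Delta n w * Omega (u(i := s)) - Omega w * Delta n (u(i := s)))"
      if "i \<in> {1..n}" "\<And>k. k \<in> {1..n} \<Longrightarrow> u k \<noteq> 0" for u i
      by (intro qsym_diff qsym_cmult qsym_Omega qsym_Delta that)
    show "Delta n w * Omega (u \<circ> Transposition.transpose i j) - Omega w * Delta n (u \<circ> Transposition.transpose i j)
        = - (Delta n w * Omega u - Omega w * Delta n u)"
      if "i \<in> {1..n}" "j \<in> {1..n}" "i \<noteq> j" "\<And>k. k \<in> {1..n} \<Longrightarrow> u k \<noteq> 0" for u i j
      using Omega_anti[OF that(1-3)] Delta_anti[OF that] by simp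
  qed auto
  thus ?thesis by (simp add: mult.commute)
qed

section \<open>Return from the average to the series\<close>

lemma H_nonzero:
  assumes z: "z \<noteq> 0" and c_nz: "\<And>j. j \<in> {1..p} \<Longrightarrow> c j \<noteq> 0"
    and nzc: "\<And>j l. j \<in> {1..p} \<Longrightarrow> 1 - c j * z * q powi l \<noteq> 0 \<and> 1 - q powi (1 - int (m j)) * z / c j * q powi l \<noteq> 0"
    and nza: "\<And>j l. j \<in> {1..2*n+2} \<Longrightarrow> 1 - q * z / a j * q powi l \<noteq> 0"
    and nza': "\<And>j l. j \<in> {1..2*n+2} \<Longrightarrow> l < 0 \<Longrightarrow> 1 - a j * z * q powi l \<noteq> 0"
  shows "H z \<noteq> 0"
proof -
  have "qpoch_inf q (q * z / a j) \<noteq> 0" if "j \<in> {1..2*n+2}" for j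
  proof
    assume "qpoch_inf q (q * z / a j) = 0"
    then obtain i where "q * z / a j * q ^ i = 1" by (auto simp: qpoch_inf_eq_0_iff)
    thus False using nza[OF that, of "int i"] by simp
  qed
  moreover have "qpoch_inf q (q / (a j * z)) \<noteq> 0" if "j \<in> {1..2*n+2}" for j
  proof
    assume "qpoch_inf q (q / (a j * z)) = 0"
    then obtain i where "q / (a j * z) * q ^ i = 1" by (auto simp: qpoch_inf_eq_0_iff)
    \<comment> \<open>Then \<open>qpoch q (a j * z)\<close> would have a zero factor in its
      denominator at the negative index \<open>- Suc i\<close>.\<close>
    hence "a j * z = q ^ Suc i" using a_nz[OF that] z by (simp add: field_simps)
    moreover have "q ^ Suc i * q powi (- int (Suc i)) = 1"
      by (simp only: power_int_minus power_int_of_nat) (rule right_inverse, simp)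
    ultimately show False using nza'[OF that, of "- int (Suc i)"] by simp
  qed
  moreover have "qpoch q (c j * z) (int (m j)) \<noteq> 0" if "j \<in> {1..p}" for j
    using nzc[OF that, of "int _"] by (auto simp: qpoch_of_nat)
  moreover have "qpoch q (c j / z) (int (m j)) \<noteq> 0" if "j \<in> {1..p}" for j
  proof -
    have "1 - c j / z * q ^ i \<noteq> 0" if i: "i < m j" for i
    proof
      assume "1 - c j / z * q ^ i = 0"
      hence zc: "z / c j = q ^ i" using z c_nz[OF \<open>j \<in> {1..p}\<close>] by (simp add: field_simps)
      \<comment> \<open>The index \<open>m j - 1 - i\<close> is the one at which the assumed zero
        \<open>z / c j = q ^ i\<close> kills the lower factor with
        \<open>q powi (1 - m j) * z / c j\<close>.\<close>
      have "q powi (1 - int (m j)) * q ^ i * q powi (int (m j) - 1 - int i) = q powi (1 - int (m j) + int i + (int (m j) - 1 - int i))"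
        by (simp only: power_int_add[OF disjI1[OF q_nz]] power_int_of_nat)
      also have "\<dots> = 1" by simp
      finally show False
        using nzc[OF \<open>j \<in> {1..p}\<close>, of "int (m j) - 1 - int i"] zc by (simp flip: times_divide_eq_right)
    qed
    thus ?thesis unfolding qpoch_of_nat by (subst prod_zero_iff) blast+
  qed
  ultimately show ?thesis by (auto simp: H_def)
qed

lemma rho_nonzero: "rho \<noteq> 0"
  using a_nz by (simp add: rho_def)

lemma series_denominators_imp_H_nonzero:
  assumes c_nz: "\<And>j. j \<in> {1..p} \<Longrightarrow> c j \<noteq> 0"
    and z: "k \<in> {1..n}" "z k \<noteq> 0"
    and den: "series_denominators_nonzero q n p m a c z"
  shows "H (z k) \<noteq> 0"
proof (rule H_nonzero[OF z(2) c_nz])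
  have C: "qpoch_well_defined q (c j * z k) l" "qpoch_well_defined q (q powi (1 - int (m j)) * z k / c j) l"
     "qpoch q (c j * z k) l \<noteq> 0" "qpoch q (q powi (1 - int (m j)) * z k / c j) l \<noteq> 0"
    if "j \<in> {1..p}" for j l
    using den z(1) that unfolding series_denominators_nonzero_def by blast+
  have A: "qpoch_well_defined q (a j * z k) l" "qpoch_well_defined q (q * z k / a j) l"
    "qpoch q (q * z k / a j) l \<noteq> 0" if "j \<in> {1..2*n+2}" for j l
    using den z(1) that unfolding series_denominators_nonzero_def by blast+
  show "1 - c j * z k * q powi l \<noteq> 0 \<and> 1 - q powi (1 - int (m j)) * z k / c j * q powi l \<noteq> 0"
    if "j \<in> {1..p}" for j l
    using qpoch_factor_nonzero[OF C(1,3)[OF that]] qpoch_factor_nonzero[OF C(2,4)[OF that]] by blast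
  show "1 - q * z k / a j * q powi l \<noteq> 0" if "j \<in> {1..2*n+2}" for j l
    by (rule qpoch_factor_nonzero[OF A(2,3)[OF that]])
  show "1 - a j * z k * q powi l \<noteq> 0" if "j \<in> {1..2*n+2}" "l < 0" for j l
    by (rule qpoch_well_definedD[OF A(1)[OF that(1)] that(2)])
qed

lemma series_term_eq:
  assumes c_nz: "\<And>j. j \<in> {1..p} \<Longrightarrow> c j \<noteq> 0"
    and z: "\<And>k. k \<in> {1..n} \<Longrightarrow> z k \<noteq> 0"
    and den: "series_denominators_nonzero q n p m a c z"
  shows "series_term q n p m a c z y * ((\<Prod>k=1..n. H (z k)) * Wsym n z) = lattice_term z y"
proof -
  define G where "G k = (\<Prod>j=1..p. (qpoch q (q ^ m j * c j * z k) (y k) * qpoch q (q * z k / c j) (y k)) /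
        (qpoch q (c j * z k) (y k) * qpoch q (q powi (1 - int (m j)) * z k / c j) (y k))) *
      (\<Prod>j=1..2*n+2. qpoch q (a j * z k) (y k) / qpoch q (q * z k / a j) (y k)) * rho powi y k" for k
  have Wz: "W n z \<noteq> 0" using den unfolding series_denominators_nonzero_def by blast
  hence Wsz: "Wsym n z \<noteq> 0" using W_eq_Wsym[of n z] z by auto
  have Pz: "(\<Prod>k=1..n. z k ^ n) \<noteq> 0" using z by auto
  have W1: "W n (qshift q z y) = (\<Prod>k=1..n. z k ^ n) * (\<Prod>k=1..n. q powi (int n * y k)) *
      Wsym n (\<lambda>k. z k * q powi y k)"
  proof -
    have "W n (qshift q z y) = (\<Prod>k=1..n. (z k * q powi y k) ^ n) * Wsym n (\<lambda>k. z k * q powi y k)"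
      unfolding qshift_def by (rule W_eq_Wsym) (use z in auto)
    also have "(\<Prod>k=1..n. (z k * q powi y k) ^ n) = (\<Prod>k=1..n. z k ^ n) * (\<Prod>k=1..n. q powi (int n * y k))"
      unfolding prod.distrib[symmetric]
      by (intro prod.cong refl) (simp add: power_mult_distrib power_int_mult mult.commute[of "int n"])
    finally show ?thesis .
  qed
  \<comment> \<open>The powers \<open>z k ^ n\<close> cancel in the quotient; only
    \<open>q powi (int n * y k)\<close> survives, to be absorbed into the weight.\<close>
  have W2: "W n (qshift q z y) / W n z * Wsym n z =
      (\<Prod>k=1..n. q powi (int n * y k)) * Wsym n (\<lambda>k. z k * q powi y k)"
    using Pz Wsz W_eq_Wsym[of n z] z by (simp add: W1)
  have S: "series_term q n p m a c z y = W n (qshift q z y) / W n z * (\<Prod>k=1..n. G k)"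
    unfolding series_term_def G_def rho_def[symmetric] power_int_sum[OF rho_nonzero] prod.distrib
    by (simp only: mult_ac)
  have G: "(\<Prod>k=1..n. G k) * (\<Prod>k=1..n. q powi (int n * y k)) * (\<Prod>k=1..n. H (z k))
      = (\<Prod>k=1..n. weight (z k) (y k) * H (z k * q powi y k))"
    unfolding prod.distrib[symmetric]
  proof (rule prod.cong[OF refl])
    fix k assume k: "k \<in> {1..n}"
    show "G k * q powi (int n * y k) * H (z k) = weight (z k) (y k) * H (z k * q powi y k)"
      unfolding G_def
    proof (rule series_factor_eq[OF z[OF k] c_nz])
      fix j l assume "j \<in> {1..p}"
      thus "qpoch_well_defined q (q ^ m j * c j * z k) l \<and>
        qpoch_well_defined q (q * z k / c j) l \<and>
        qpoch_well_defined q (c j * z k) l \<and>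
        qpoch_well_defined q (q powi (1 - int (m j)) * z k / c j) l \<and>
        qpoch q (c j * z k) l \<noteq> 0 \<and>
        qpoch q (q powi (1 - int (m j)) * z k / c j) l \<noteq> 0"
        using den k unfolding series_denominators_nonzero_def by blast
    next
      fix j l assume "j \<in> {1..2*n+2}"
      thus "qpoch_well_defined q (a j * z k) l \<and> qpoch_well_defined q (q * z k / a j) l \<and>
          qpoch q (q * z k / a j) l \<noteq> 0"
        using den k unfolding series_denominators_nonzero_def by blast
    qed
  qed
  have "series_term q n p m a c z y * ((\<Prod>k=1..n. H (z k)) * Wsym n z)
      = (W n (qshift q z y) / W n z * Wsym n z) * (\<Prod>k=1..n. G k) * (\<Prod>k=1..n. H (z k))"
    unfolding S by (simp only: mult_ac)
  also have "\<dots> = ((\<Prod>k=1..n. G k) * (\<Prod>k=1..n. q powi (int n * y k)) * (\<Prod>k=1..n. H (z k))) *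
      Wsym n (\<lambda>k. z k * q powi y k)"
    unfolding W2 by (simp only: mult_ac)
  also have "\<dots> = lattice_term z y"
    unfolding G lattice_term_def ..
  finally show ?thesis .
qed

lemma series_sum:
  assumes c_nz: "\<And>j. j \<in> {1..p} \<Longrightarrow> c j \<noteq> 0"
    and z: "\<And>k. k \<in> {1..n} \<Longrightarrow> z k \<noteq> 0"
    and den: "series_denominators_nonzero q n p m a c z"
  shows "(\<lambda>y. norm (series_term q n p m a c z y)) summable_on int_lattice n" (is ?summable)
    and "(\<Sum>\<^sub>\<infinity>y\<in>int_lattice n. series_term q n p m a c z y) * ((\<Prod>k=1..n. H (z k)) * Wsym n z) = Omega z"
      (is ?sum)
    and "Wsym n z \<noteq> 0" (is ?Wsym)
proof -
  define D where "D = (\<Prod>k=1..n. H (z k)) * Wsym n z"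
  have "W n z \<noteq> 0" using den unfolding series_denominators_nonzero_def by blast
  thus ?Wsym using W_eq_Wsym[of n z] z by auto
  hence D: "D \<noteq> 0"
    using series_denominators_imp_H_nonzero[OF c_nz _ z den] by (auto simp: D_def)
  have eq: "series_term q n p m a c z y = inverse D * lattice_term z y" for y
    using series_term_eq[OF assms, of y] D unfolding D_def[symmetric] by (simp add: field_simps)
  show ?summable
    unfolding eq norm_mult by (intro summable_on_cmult_right norm_lattice_term_summable z)
  have "(\<Sum>\<^sub>\<infinity>y\<in>int_lattice n. series_term q n p m a c z y) = inverse D * Omega z"
    unfolding eq Omega_def by (rule infsum_cmult_right')
  thus ?sum using D unfolding D_def[symmetric] by simp
qed

end

section \<open>General position and the transformation\<close>

context nome
begin

text \<open>The denominators with \<open>w\<close> on the right-hand side are theta functions of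
  \<open>w j * w k\<close> and \<open>w j / w k\<close> without their factors \<open>1 - x\<close>;
  these factors are supplied by \<open>W n w\<close>. Hence the theta functions do not vanish, and
  their arguments avoid the powers of \<open>q\<close>.\<close>

lemma genericI:
  assumes w: "\<And>k. k \<in> {1..n} \<Longrightarrow> w k \<noteq> 0" and W: "W n w \<noteq> 0"
    and ww: "\<And>j k. 1 \<le> j \<Longrightarrow> j \<le> k \<Longrightarrow> k \<le> n \<Longrightarrow>
        qpoch_inf q (q * w j * w k) \<noteq> 0 \<and> qpoch_inf q (q / (w j * w k)) \<noteq> 0"
    and wd: "\<And>j k. j \<in> {1..n} \<Longrightarrow> k \<in> {1..n} \<Longrightarrow> qpoch_inf q (q * w k / w j) \<noteq> 0"
  shows "generic n w"
proof -
  have W': "(\<Prod>j=1..n. \<Prod>k=j..n. 1 - w j * w k) \<noteq> 0" "(\<Prod>(j, k)\<in>pairs n. w j - w k) \<noteq> 0"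
    using W unfolding W_def prod_pairs mult_eq_0_iff by blast+
  have "w j * w k \<noteq> q powi l" if jk: "1 \<le> j" "j \<le> k" "k \<le> n" for j k l
  proof -
    have "(\<Prod>k=j..n. 1 - w j * w k) \<noteq> 0"
      using W'(1) jk by (subst (asm) prod_zero_iff) auto
    hence "1 - w j * w k \<noteq> 0"
      using jk by (subst (asm) prod_zero_iff) auto
    hence "theta (w j * w k) \<noteq> 0"
      using ww[OF jk] by (simp add: theta_eq mult.assoc)
    thus ?thesis using theta_eq_0_iff[of "w j * w k"] w[of j] w[of k] jk by auto
  qed
  hence 1: "w j * w k \<noteq> q powi l" if "j \<in> {1..n}" "k \<in> {1..n}" for j k l
    using that by (metis atLeastAtMost_iff mult.commute nle_le)
  have 2: "w j \<noteq> w k * q powi l" if jk: "j \<in> {1..n}" "k \<in> {1..n}" "j \<noteq> k" for j k l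
  proof -
    have ne: "w a \<noteq> w b" if "(a, b) \<in> pairs n" for a b
      using W'(2) that by (subst (asm) prod_zero_iff) auto
    have "w j \<noteq> w k"
      using ne[of j k] ne[of k j] jk by (cases "j < k") (auto simp: mem_pairs)
    hence "1 - w j / w k \<noteq> 0" using w[OF jk(2)] by simp
    hence "theta (w j / w k) \<noteq> 0"
      using wd[OF jk(1,2)] wd[OF jk(2,1)] by (simp add: theta_eq)
    hence "w j / w k \<noteq> q powi l"
      using theta_eq_0_iff[of "w j / w k"] w[OF jk(1)] w[OF jk(2)] by auto
    thus ?thesis using w[OF jk(2)] by auto
  qed
  show ?thesis unfolding generic_def using w 1 2 by blast
qed

end

theorem corollary4p1:
  fixes q :: complex
    and n p :: nat
    and m :: "nat \<Rightarrow> nat"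
    and a c z w :: "nat \<Rightarrow> complex"
  assumes q: "0 < norm q" "norm q < 1"
    and n: "n \<ge> 1" and p: "p \<ge> 1"
    and conv: "norm (q powi (1 - int (\<Sum>j=1..p. m j)) / (\<Prod>j=1..2*n+2. a j)) < 1"
    and a_nz: "\<And>j. j \<in> {1..2*n+2} \<Longrightarrow> a j \<noteq> 0"
    and c_nz: "\<And>j. j \<in> {1..p} \<Longrightarrow> c j \<noteq> 0"
    and zw_nz: "\<And>k. k \<in> {1..n} \<Longrightarrow> z k \<noteq> 0 \<and> w k \<noteq> 0"
    and series_z: "series_denominators_nonzero q n p m a c z"
    and series_w: "series_denominators_nonzero q n p m a c w"
    and den_ww: "\<And>j k. 1 \<le> j \<Longrightarrow> j \<le> k \<Longrightarrow> k \<le> n \<Longrightarrow>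
        qpoch_inf q (q * w j * w k) \<noteq> 0 \<and> qpoch_inf q (q / (w j * w k)) \<noteq> 0"
    and den_w: "\<And>j k. j \<in> {1..n} \<Longrightarrow> k \<in> {1..n} \<Longrightarrow> qpoch_inf q (q * w k / w j) \<noteq> 0"
    and den_az: "\<And>j k. j \<in> {1..2*n+2} \<Longrightarrow> k \<in> {1..n} \<Longrightarrow>
        qpoch_inf q (q * z k / a j) \<noteq> 0 \<and> qpoch_inf q (q / (a j * z k)) \<noteq> 0"
    and den_cz: "\<And>j k. j \<in> {1..p} \<Longrightarrow> k \<in> {1..n} \<Longrightarrow>
        qpoch q (c j * z k) (int (m j)) \<noteq> 0 \<and> qpoch q (c j / z k) (int (m j)) \<noteq> 0"
  shows "(\<lambda>y. norm (series_term q n p m a c z y)) summable_on int_lattice n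
    \<and> (\<lambda>y. norm (series_term q n p m a c w y)) summable_on int_lattice n
    \<and> (\<Sum>\<^sub>\<infinity>y\<in>int_lattice n. series_term q n p m a c z y) =
        (\<Prod>j=1..n. \<Prod>k=j..n.
           (qpoch_inf q (q * z j * z k) * qpoch_inf q (q / (z j * z k))) /
           (qpoch_inf q (q * w j * w k) * qpoch_inf q (q / (w j * w k)))) *
        (\<Prod>j=1..n. \<Prod>k=1..n. qpoch_inf q (q * z k / z j) / qpoch_inf q (q * w k / w j)) *
        (\<Prod>k=1..n. \<Prod>j=1..2*n+2.
           (qpoch_inf q (q * w k / a j) * qpoch_inf q (q / (a j * w k))) /
           (qpoch_inf q (q * z k / a j) * qpoch_inf q (q / (a j * z k)))) *
        (\<Prod>k=1..n. \<Prod>j=1..p.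
           (qpoch q (c j * w k) (int (m j)) * qpoch q (c j / w k) (int (m j))) /
           (qpoch q (c j * z k) (int (m j)) * qpoch q (c j / z k) (int (m j)))) *
        (\<Sum>\<^sub>\<infinity>y\<in>int_lattice n. series_term q n p m a c w y)"
proof -
  interpret kernel q n p m a c
    by unfold_locales (use q a_nz conv in auto)
  have z0: "z k \<noteq> 0" and w0: "w k \<noteq> 0" if "k \<in> {1..n}" for k
    using zw_nz[OF that] by auto
  define Sz where "Sz = (\<Sum>\<^sub>\<infinity>y\<in>int_lattice n. series_term q n p m a c z y)"
  define Sw where "Sw = (\<Sum>\<^sub>\<infinity>y\<in>int_lattice n. series_term q n p m a c w y)"
  define K where "K u = (\<Prod>j=1..n. \<Prod>k=j..n. qpoch_inf q (q * u j * u k) * qpoch_inf q (q / (u j * u k)))" for u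
  define L where "L u = (\<Prod>j=1..n. \<Prod>k=1..n. qpoch_inf q (q * u k / u j))" for u
  define P where "P u = (\<Prod>k=1..n. \<Prod>j=1..2*n+2. qpoch_inf q (q * u k / a j) * qpoch_inf q (q / (a j * u k)))" for u
  define C where "C u = (\<Prod>k=1..n. \<Prod>j=1..p. qpoch q (c j * u k) (int (m j)) * qpoch q (c j / u k) (int (m j)))" for u
  have PC: "(\<Prod>k=1..n. H (u k)) = P u * C u" for u
    by (simp only: H_def P_def C_def prod.distrib)
  have sum_z: "Sz * (P z * C z * Wsym n z) = Omega z"
    unfolding Sz_def PC[symmetric] by (rule series_sum(2)[OF c_nz z0 series_z])
  have Wz: "Wsym n z \<noteq> 0"
    by (rule series_sum(3)[OF c_nz z0 series_z])
  have summable_z: "(\<lambda>y. norm (series_term q n p m a c z y)) summable_on int_lattice n"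
    by (rule series_sum(1)[OF c_nz z0 series_z])
  have sum_w: "Sw * (P w * C w * Wsym n w) = Omega w"
    unfolding Sw_def PC[symmetric] by (rule series_sum(2)[OF c_nz w0 series_w])
  have Ww: "Wsym n w \<noteq> 0"
    by (rule series_sum(3)[OF c_nz w0 series_w])
  have summable_w: "(\<lambda>y. norm (series_term q n p m a c w y)) summable_on int_lattice n"
    by (rule series_sum(1)[OF c_nz w0 series_w])
  have Dz: "Delta n z * qpoch_inf q q ^ n = (- 1) ^ card (pairs n) * Wsym n z * K z * L z"
    unfolding K_def L_def by (rule Delta_eq_Wsym[OF z0])
  have Dw: "Delta n w * qpoch_inf q q ^ n = (- 1) ^ card (pairs n) * Wsym n w * K w * L w"
    unfolding K_def L_def by (rule Delta_eq_Wsym[OF w0])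
  have "W n w \<noteq> 0" using series_w unfolding series_denominators_nonzero_def by blast
  hence gen: "generic n w" by (intro genericI w0 den_ww den_w)
  have Kw: "K w \<noteq> 0"
    unfolding K_def using den_ww by (auto simp: prod_zero_iff)
  have Lw: "L w \<noteq> 0"
    unfolding L_def using den_w by (auto simp: prod_zero_iff)
  have Pz: "P z \<noteq> 0"
    unfolding P_def using den_az by (subst prod_zero_iff, simp, subst prod_zero_iff, simp) fastforce
  have Cz: "C z \<noteq> 0"
    unfolding C_def using den_cz by (subst prod_zero_iff, simp, subst prod_zero_iff, simp) fastforce
  \<comment> \<open>Both sides carry the power of \<open>qpoch_inf q q\<close>, so the product
    formulas for \<open>Delta\<close> can be substituted without division.\<close>
  have "Omega z * (Delta n w * qpoch_inf q q ^ n) = Omega w * (Delta n z * qpoch_inf q q ^ n)"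
    using Omega_Delta[OF gen z0] by (simp only: mult.assoc[symmetric])
  hence "((- 1) ^ card (pairs n) * Wsym n z * Wsym n w) * (Sz * P z * C z * (K w * L w)) =
      ((- 1) ^ card (pairs n) * Wsym n z * Wsym n w) * (K z * L z * (P w * C w) * Sw)"
    unfolding Dz Dw sum_z[symmetric] sum_w[symmetric] by (simp only: mult_ac)
  \<comment> \<open>The sign and both values of \<open>Wsym\<close> occur symmetrically in
    \<open>z\<close> and \<open>w\<close> and are nonzero.\<close>
  hence "Sz * P z * C z * (K w * L w) = K z * L z * (P w * C w) * Sw"
    by (rule mult_left_cancel[THEN iffD1, rotated]) (use Wz Ww in simp)
  hence main: "Sz = (K z / K w) * (L z / L w) * (P w / P z) * (C w / C z) * Sw"
    using Kw Lw Pz Cz by (simp add: field_simps)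
  show ?thesis
    using summable_z summable_w main
    unfolding Sz_def Sw_def K_def L_def P_def C_def prod_dividef by blast
qed

end
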